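(* Let $\mathbb{K}$ be a field and let $G$ be a connected non-bipartite simple graph on $[n]$ such that $G\setminus e$ is a bipartite graph for some edge $e=\{u,v\}\in E(G)$. If $G$ is not an odd cycle, then $\operatorname{reg}(S/\mathcal{I}_G)\leq n-1$, where $S=\mathbb{K}[x_1,\ldots,x_n,y_1,\ldots,y_n]$ and $\mathcal{I}_G=(x_ix_j-y_iy_j : \{i,j\}\in E(G))$.
   Context: $G\setminus e$ denotes the graph on $V(G)$ with edge set $E(G)\setminus\{e\}$. $S$ is standard graded and $\operatorname{reg}(M)=\max\{j-i : \beta^S_{i,j}(M)\neq 0\}$ for a finitely generated graded $S$-module $M$. *)

theory Defs
  imports Main "HOL-Library.Poly_Mapping"
begin

definition simple_graph :: "nat \<Rightarrow> nat set set \<Rightarrow> bool" where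
  "simple_graph n E \<longleftrightarrow> (\<forall>e\<in>E. \<exists>i j. e = {i, j} \<and> i \<noteq> j \<and> i \<in> {1..n} \<and> j \<in> {1..n})"

definition adj :: "nat set set \<Rightarrow> nat \<Rightarrow> nat \<Rightarrow> bool" where
  "adj E i j \<longleftrightarrow> {i, j} \<in> E \<and> i \<noteq> j"

definition graph_connected :: "nat \<Rightarrow> nat set set \<Rightarrow> bool" where
  "graph_connected n E \<longleftrightarrow> (\<forall>i\<in>{1..n}. \<forall>j\<in>{1..n}. (adj E)\<^sup>*\<^sup>* i j)"

definition bipartite :: "nat \<Rightarrow> nat set set \<Rightarrow> bool" where
  "bipartite n E \<longleftrightarrow> (\<exists>c :: nat \<Rightarrow> bool. \<forall>i j. {i, j} \<in> E \<longrightarrow> c i \<noteq> c j)"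

definition is_odd_cycle :: "nat \<Rightarrow> nat set set \<Rightarrow> bool" where
  "is_odd_cycle n E \<longleftrightarrow> odd n \<and> n \<ge> 3 \<and>
     (\<exists>v :: nat \<Rightarrow> nat. bij_betw v {..<n} {1..n} \<and>
        E = {{v i, v ((i + 1) mod n)} | i. i < n})"

text \<open>Polynomials over 'k in variables indexed by nat; x_i is variable i and
  y_i is variable n + i. S is the subring of polynomials in variables 1..2n.\<close>

type_synonym 'k mpoly = "(nat \<Rightarrow>\<^sub>0 nat) \<Rightarrow>\<^sub>0 'k"

definition var :: "nat \<Rightarrow> 'k::field mpoly" where
  "var i = Poly_Mapping.single (Poly_Mapping.single i 1) 1"

definition xv :: "nat \<Rightarrow> nat \<Rightarrow> 'k::field mpoly" where
  "xv n i = var i"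

definition yv :: "nat \<Rightarrow> nat \<Rightarrow> 'k::field mpoly" where
  "yv n i = var (n + i)"

definition polyS :: "nat \<Rightarrow> 'k::field mpoly set" where
  "polyS n = {p. \<forall>m\<in>Poly_Mapping.keys p. Poly_Mapping.keys m \<subseteq> {1..2*n}}"

definition mon_deg :: "(nat \<Rightarrow>\<^sub>0 nat) \<Rightarrow> nat" where
  "mon_deg m = (\<Sum>i\<in>Poly_Mapping.keys m. Poly_Mapping.lookup m i)"

definition homogeneous :: "nat \<Rightarrow> 'k::field mpoly \<Rightarrow> bool" where
  "homogeneous t p \<longleftrightarrow> (\<forall>m\<in>Poly_Mapping.keys p. mon_deg m = t)"

definition idealIG :: "nat \<Rightarrow> nat set set \<Rightarrow> 'k::field mpoly set" where
  "idealIG n E = {(\<Sum>e\<in>E. c e * (\<Prod>i\<in>e. xv n i) - c e * (\<Prod>i\<in>e. yv n i)) | c.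
                   \<forall>e. c e \<in> polyS n}"

text \<open>A graded free resolution ... -> F_2 -> F_1 -> F_0 -> S/I -> 0 is encoded by
  ranks b i, shifts d i k (F_i = direct sum of S(-d i k), k < b i), and matrices
  A i l k (i >= 1) giving the map F_i -> F_(i-1) on the basis vector e_k.
  Elements of F_i are functions v :: nat => poly with v k in S for k < b i and 0 otherwise.\<close>

definition free_mod :: "nat \<Rightarrow> nat \<Rightarrow> (nat \<Rightarrow> 'k::field mpoly) set" where
  "free_mod n r = {v. \<forall>k. (k < r \<longrightarrow> v k \<in> polyS n) \<and> (r \<le> k \<longrightarrow> v k = 0)}"

definition res_map :: "(nat \<Rightarrow> nat) \<Rightarrow> (nat \<Rightarrow> nat \<Rightarrow> nat \<Rightarrow> 'k::field mpoly) \<Rightarrow> nat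
     \<Rightarrow> (nat \<Rightarrow> 'k mpoly) \<Rightarrow> (nat \<Rightarrow> 'k mpoly)" where
  "res_map b A i v = (\<lambda>l. if l < b (i - 1) then (\<Sum>k<b i. A i l k * v k) else 0)"

text \<open>Minimal graded free resolution of S/I with F_0 = S (generated in degree 0)
  and augmentation the quotient map S -> S/I. Graded of degree 0 and minimal
  (entries in the maximal homogeneous ideal) together say: every nonzero entry
  A i l k is homogeneous of degree d i k - d (i-1) l, and this degree is positive.\<close>
definition min_graded_free_res ::
  "nat \<Rightarrow> 'k::field mpoly set \<Rightarrow> (nat \<Rightarrow> nat) \<Rightarrow> (nat \<Rightarrow> nat \<Rightarrow> nat)
     \<Rightarrow> (nat \<Rightarrow> nat \<Rightarrow> nat \<Rightarrow> 'k mpoly) \<Rightarrow> bool" where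
  "min_graded_free_res n I b d A \<longleftrightarrow>
     b 0 = 1 \<and> d 0 0 = 0 \<and>
     (\<forall>i\<ge>1. \<forall>l<b (i - 1). \<forall>k<b i.
        A i l k \<in> polyS n \<and>
        (A i l k \<noteq> 0 \<longrightarrow> d (i - 1) l < d i k \<and> homogeneous (d i k - d (i - 1) l) (A i l k))) \<and>
     res_map b A 1 ` free_mod n (b 1) = {v \<in> free_mod n 1. v 0 \<in> I} \<and>
     (\<forall>i\<ge>1. res_map b A (i + 1) ` free_mod n (b (i + 1)) =
              {v \<in> free_mod n (b i). res_map b A i v = (\<lambda>_. 0)})"

definition graded_betti :: "(nat \<Rightarrow> nat) \<Rightarrow> (nat \<Rightarrow> nat \<Rightarrow> nat) \<Rightarrow> nat \<Rightarrow> nat \<Rightarrow> nat" where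
  "graded_betti b d i j = card {k. k < b i \<and> d i k = j}"

end

theory Submission
  imports Defs
begin

text \<open>Let \<open>H = G - {u, v}\<close>, a bipartite graph in which \<open>u\<close> and \<open>v\<close> lie on the same side. After
  exchanging \<open>x\<close> and \<open>y\<close> on one side, \<open>I\<^sub>H\<close> is the binomial edge ideal \<open>J\<^sub>H\<close>, and
  \<open>I\<^sub>G = J\<^sub>H + (f)\<close> for a quadric \<open>f\<close>. Let \<open>K\<close> be \<open>H\<close> with the neighbourhoods of \<open>u\<close> and \<open>v\<close>
  completed; then \<open>J\<^sub>H : f = J\<^sub>K\<close>, so it suffices that \<open>reg (S / J\<^sub>H) \<le> n - 1\<close> and
  \<open>reg (S / J\<^sub>K) \<le> n - 2\<close>. Both bounds, the second for every graph that is not a path, follow by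
  induction from Ohtani's decomposition \<open>J\<^sub>L = J\<^bsub>L_w\<^esub> \<inter> ((x\<^sub>w, y\<^sub>w) + J\<^bsub>L-w\<^esub>)\<close> at a
  non-simplicial vertex \<open>w\<close> of a graph \<open>L\<close>, where \<open>L_w\<close> completes the neighbourhood of \<open>w\<close>;
  the induction ends at disjoint unions of cliques, whose ideals are toric. If \<open>K\<close> is a path, then \<open>u\<close> and \<open>v\<close> are its
  endpoints, \<open>K = H\<close>, and \<open>G\<close> is an odd cycle. Regularity is measured by Koszul homology, which
  is compared with the given resolution by dimension shifting.\<close>

section \<open>Polynomials\<close>

text \<open>The two bounds differ because of the degree of \<open>f\<close>: in 0 -> (S/J_K)(-2) ->
  S/J_H -> S/I_G -> 0 the twist costs 2 and the connecting map gives back 1, so S/J_K has to stay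
  one below the target n - 1. A path on n vertices gives a complete intersection of n - 1 quadrics,
  of regularity exactly n - 1, and this is why \<open>K\<close> must not be a path. The colon
  identity rests on the Pluecker relation x_w f_ab = x_a f_wb - x_b f_wa: a variable at w multiplies
  J of the completed graph back into J of the original one. Used at v and then at u, it gives f J_K
  \<subseteq> J_H. Conversely, u and v are simplicial in \<open>K\<close>, so no decomposition step
  ever deletes them; \<open>f\<close> keeps its shape in all the toric ideals at the end and is a
  nonzerodivisor modulo J_K. The theorem speaks of an arbitrary given resolution of one ideal,
  whereas the exact sequences pass through many ideals. Koszul homology is defined for all of them
  by the same complex, so the resolution has to be touched only once.\<close>

lemma pm_expand: "(p :: 'a \<Rightarrow>\<^sub>0 'b::comm_monoid_add) = (\<Sum>m\<in>Poly_Mapping.keys p. Poly_Mapping.single m (Poly_Mapping.lookup p m))"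
  by (rule poly_mapping_eqI)
    (auto simp: lookup_sum lookup_single when_def in_keys_iff)

lemma pm_induct [case_names zero single add]:
  assumes "P 0" "\<And>m a. P (Poly_Mapping.single m a)" "\<And>p q. P p \<Longrightarrow> P q \<Longrightarrow> P (p + q)"
  shows "P (p :: 'a \<Rightarrow>\<^sub>0 'b::comm_monoid_add)"
proof -
  have "P (\<Sum>m\<in>A. Poly_Mapping.single m (Poly_Mapping.lookup p m))" if "finite A" for A
    using that by induction (auto intro: assms)
  from this[of "Poly_Mapping.keys p"] show ?thesis by (simp flip: pm_expand)
qed

lemma polyS_0 [simp]: "0 \<in> polyS n"
  by (simp add: polyS_def)

lemma polyS_add [intro]: "p \<in> polyS n \<Longrightarrow> q \<in> polyS n \<Longrightarrow> p + q \<in> polyS n"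
  unfolding polyS_def using keys_add[of p q] by blast

lemma polyS_uminus [intro]: "p \<in> polyS n \<Longrightarrow> - p \<in> polyS n"
  by (simp add: polyS_def)

lemma polyS_diff [intro]: "p \<in> polyS n \<Longrightarrow> q \<in> polyS n \<Longrightarrow> p - q \<in> polyS n"
  unfolding polyS_def using keys_diff[of p q] by blast

lemma keys_mon_add: "Poly_Mapping.keys (m + m' :: 'a \<Rightarrow>\<^sub>0 nat) = Poly_Mapping.keys m \<union> Poly_Mapping.keys m'"
  by (auto simp: in_keys_iff lookup_add)

lemma polyS_mult [intro]: "p \<in> polyS n \<Longrightarrow> q \<in> polyS n \<Longrightarrow> p * q \<in> polyS n"
  unfolding polyS_def using keys_mult[of p q] by (fastforce simp: keys_mon_add)

lemma polyS_sum [intro]: "(\<And>i. i \<in> A \<Longrightarrow> f i \<in> polyS n) \<Longrightarrow> sum f A \<in> polyS n"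
  by (induction A rule: infinite_finite_induct) auto

lemma polyS_single: "Poly_Mapping.keys m \<subseteq> {1..2*n} \<Longrightarrow> Poly_Mapping.single m a \<in> polyS n"
  by (simp add: polyS_def)

lemma polyS_1 [simp]: "1 \<in> polyS n"
  by (simp add: polyS_def)

lemma polyS_var [intro]: "k \<in> {1..2*n} \<Longrightarrow> var k \<in> polyS n"
  by (simp add: polyS_def var_def)

lemma polyS_neg1_power [simp]: "(- 1) ^ j \<in> polyS n"
  by (induction j) auto

lemma mon_deg_sum:
  assumes "finite A" "Poly_Mapping.keys m \<subseteq> A"
  shows "mon_deg m = (\<Sum>i\<in>A. Poly_Mapping.lookup m i)"
  unfolding mon_deg_def using assms by (intro sum.mono_neutral_left) (auto simp: in_keys_iff)

lemma mon_deg_add: "mon_deg (m + m') = mon_deg m + mon_deg m'"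
  using mon_deg_sum[of "Poly_Mapping.keys m \<union> Poly_Mapping.keys m'"]
  by (simp add: keys_mon_add lookup_add sum.distrib)

lemma mon_deg_0 [simp]: "mon_deg 0 = 0"
  by (simp add: mon_deg_def)

lemma mon_deg_single [simp]: "mon_deg (Poly_Mapping.single k a) = a"
  by (simp add: mon_deg_def)

lemma homogeneous_0 [simp]: "homogeneous e 0"
  by (simp add: homogeneous_def)

lemma homogeneous_add: "homogeneous e p \<Longrightarrow> homogeneous e q \<Longrightarrow> homogeneous e (p + q)"
  unfolding homogeneous_def using keys_add[of p q] by blast

lemma homogeneous_uminus: "homogeneous e p \<Longrightarrow> homogeneous e (- p)"
  by (simp add: homogeneous_def)

lemma homogeneous_diff: "homogeneous e p \<Longrightarrow> homogeneous e q \<Longrightarrow> homogeneous e (p - q)"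
  unfolding homogeneous_def using keys_diff[of p q] by blast

lemma homogeneous_sum: "(\<And>i. i \<in> A \<Longrightarrow> homogeneous e (f i)) \<Longrightarrow> homogeneous e (sum f A)"
  by (induction A rule: infinite_finite_induct) (auto intro: homogeneous_add)

lemma homogeneous_mult: "homogeneous e p \<Longrightarrow> homogeneous e' q \<Longrightarrow> homogeneous (e + e') (p * q)"
  unfolding homogeneous_def using keys_mult[of p q] by (fastforce simp: mon_deg_add)

lemma homogeneous_var: "homogeneous (Suc 0) (var k)"
  by (simp add: homogeneous_def var_def)

lemma homogeneous_neg1_power: "homogeneous 0 ((- 1) ^ j)"
proof (induction j)
  case 0 show ?case by (simp add: homogeneous_def)
next
  case (Suc j)
  then show ?case by (simp add: homogeneous_uminus)
qed

section \<open>Selecting terms by their monomials, and homogeneous components\<close>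

lift_definition pfilter :: "('a \<Rightarrow> bool) \<Rightarrow> ('a \<Rightarrow>\<^sub>0 'b::zero) \<Rightarrow> ('a \<Rightarrow>\<^sub>0 'b)"
  is "\<lambda>P f k. if P k then f k else 0"
  by (erule rev_finite_subset) auto

lemma lookup_pfilter: "Poly_Mapping.lookup (pfilter P p) m = (if P m then Poly_Mapping.lookup p m else 0)"
  by transfer simp

lemma keys_pfilter: "Poly_Mapping.keys (pfilter P p) = {m \<in> Poly_Mapping.keys p. P m}"
  by (auto simp: in_keys_iff lookup_pfilter split: if_splits)

lemma pfilter_0 [simp]: "pfilter P 0 = 0"
  by (simp add: poly_mapping_eq_iff fun_eq_iff lookup_pfilter)

lemma pfilter_add: "pfilter P (p + q) = pfilter P p + pfilter P (q :: 'a \<Rightarrow>\<^sub>0 'b::monoid_add)"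
  by (simp add: poly_mapping_eq_iff fun_eq_iff lookup_pfilter lookup_add)

lemma pfilter_diff: "pfilter P (p - q) = pfilter P p - pfilter P (q :: 'a \<Rightarrow>\<^sub>0 'b::ab_group_add)"
  by (simp add: poly_mapping_eq_iff fun_eq_iff lookup_pfilter lookup_minus)

lemma pfilter_sum: "pfilter P (sum f A) = (\<Sum>i\<in>A. pfilter P (f i :: 'a \<Rightarrow>\<^sub>0 'b::comm_monoid_add))"
  by (induction A rule: infinite_finite_induct) (auto simp: pfilter_add)

lemma pfilter_single: "pfilter P (Poly_Mapping.single m a) = (if P m then Poly_Mapping.single m a else 0)"
  by (auto simp: poly_mapping_eq_iff fun_eq_iff lookup_pfilter lookup_single when_def)

lemma pfilter_id: "(\<And>m. m \<in> Poly_Mapping.keys p \<Longrightarrow> P m) \<Longrightarrow> pfilter P p = p"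
  by (auto simp: poly_mapping_eq_iff fun_eq_iff lookup_pfilter in_keys_iff)

lemma pfilter_none: "(\<And>m. m \<in> Poly_Mapping.keys p \<Longrightarrow> \<not> P m) \<Longrightarrow> pfilter P p = 0"
  by (auto simp: poly_mapping_eq_iff fun_eq_iff lookup_pfilter in_keys_iff)

text \<open>The condition on a product is read off the second factor alone. A homogeneous
  \<open>f\<close> makes this work for degrees, an \<open>f\<close> free of certain variables for
  the vanishing of those variables.\<close>

lemma pfilter_mult:
  fixes f a :: "'a::monoid_add \<Rightarrow>\<^sub>0 'b::semiring_0"
  assumes "\<And>m m'. m \<in> Poly_Mapping.keys f \<Longrightarrow> Q (m + m') \<longleftrightarrow> P m'"
  shows "pfilter Q (f * a) = f * pfilter P a"
proof -
  have *: "pfilter Q (Poly_Mapping.single m c * a) = Poly_Mapping.single m c * pfilter P a"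
    if "m \<in> Poly_Mapping.keys f" for m c
  proof (induction a rule: pm_induct)
    case (single m' b) then show ?case using assms[OF that]
      by (simp add: mult_single pfilter_single)
  qed (auto simp: algebra_simps pfilter_add)
  show ?thesis
    by (subst (1 2) pm_expand[of f]) (simp add: sum_distrib_right pfilter_sum * cong: sum.cong)
qed

lemma polyS_pfilter [intro]: "p \<in> polyS n \<Longrightarrow> pfilter P p \<in> polyS n"
  by (auto simp: polyS_def keys_pfilter)

definition hcomp :: "nat \<Rightarrow> 'k::field mpoly \<Rightarrow> 'k mpoly" where
  "hcomp e = pfilter (\<lambda>m. mon_deg m = e)"

lemma homogeneous_hcomp: "homogeneous e (hcomp e p)"
  by (simp add: homogeneous_def hcomp_def keys_pfilter)

lemma hcomp_0 [simp]: "hcomp e 0 = 0"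
  by (simp add: hcomp_def)

lemma hcomp_id: "homogeneous e p \<Longrightarrow> hcomp e p = p"
  unfolding hcomp_def homogeneous_def by (rule pfilter_id) auto

lemma hcomp_add: "hcomp e (p + q) = hcomp e p + hcomp e q"
  by (simp add: hcomp_def pfilter_add)

lemma hcomp_sum: "hcomp e (sum f A) = (\<Sum>i\<in>A. hcomp e (f i))"
  by (simp add: hcomp_def pfilter_sum)

lemma hcomp_mult: "homogeneous d f \<Longrightarrow> hcomp (d + e) (f * a) = f * hcomp e a"
  unfolding hcomp_def by (rule pfilter_mult) (auto simp: homogeneous_def mon_deg_add)

lemma hcomp_mult_0:
  assumes "homogeneous d f" "e < d" shows "hcomp e (f * a) = 0"
  unfolding hcomp_def
proof (rule pfilter_none)
  fix m assume "m \<in> Poly_Mapping.keys (f * a)"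
  then show "mon_deg m \<noteq> e"
    using keys_mult[of f a] assms by (fastforce simp: homogeneous_def mon_deg_add)
qed

lemma polyS_hcomp [intro]: "p \<in> polyS n \<Longrightarrow> hcomp e p \<in> polyS n"
  by (auto simp: hcomp_def)

lemma const_coeff_homogeneous_pos:
  assumes "homogeneous d f" "0 < d" shows "Poly_Mapping.lookup (f * a) 0 = 0"
proof -
  have "hcomp 0 (f * a) = 0" by (rule hcomp_mult_0) (use assms in auto)
  then have "Poly_Mapping.lookup (hcomp 0 (f * a)) 0 = 0" by simp
  then show ?thesis by (simp add: hcomp_def lookup_pfilter)
qed

section \<open>Koszul homology and regularity\<close>

text \<open>A Koszul chain with coefficients in \<open>S\<close> is a function on the subsets of the variables, so
  all homological degrees are treated at once. Since \<open>bd\<close> raises the coefficient degree by one,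
  \<open>reg_le n I r\<close> says that the Koszul homology of \<open>S / I\<close> with coefficient degree above \<open>r\<close>
  vanishes, that is, that the regularity of \<open>S / I\<close> is at most \<open>r\<close>.\<close>

definition sg :: "nat \<Rightarrow> nat set \<Rightarrow> 'k::field mpoly" where
  "sg k T = (- 1) ^ card {t \<in> T. t < k}"

definition bd :: "nat \<Rightarrow> (nat set \<Rightarrow> 'k::field mpoly) \<Rightarrow> nat set \<Rightarrow> 'k mpoly" where
  "bd n c T = (\<Sum>k\<in>{1..2*n} - T. sg k T * var k * c (insert k T))"

text \<open>The coefficient at \<open>T\<close> of the exterior product of the basis vector
  \<open>e_z\<close> with \<open>c\<close>; it is the homotopy for multiplication by
  \<open>var z\<close>.\<close>

definition wedge :: "nat \<Rightarrow> (nat set \<Rightarrow> 'k::field mpoly) \<Rightarrow> nat set \<Rightarrow> 'k mpoly" where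
  "wedge z c T = (if z \<in> T then sg z (T - {z}) * c (T - {z}) else 0)"

text \<open>Values off the subsets of the variables are arbitrary, so equalities of chains are
  always stated for \<open>T \<subseteq> {1..2*n}\<close>.\<close>

definition chain :: "nat \<Rightarrow> nat \<Rightarrow> (nat set \<Rightarrow> 'k::field mpoly) \<Rightarrow> bool" where
  "chain n e c \<longleftrightarrow> (\<forall>T\<subseteq>{1..2*n}. c T \<in> polyS n \<and> homogeneous e (c T))"

definition reg_le :: "nat \<Rightarrow> 'k::field mpoly set \<Rightarrow> nat \<Rightarrow> bool" where
  "reg_le n I r \<longleftrightarrow> (\<forall>e\<ge>r. \<forall>c. chain n (Suc e) c \<longrightarrow> (\<forall>T\<subseteq>{1..2*n}. bd n c T \<in> I) \<longrightarrow>
     (\<exists>b. chain n e b \<and> (\<forall>T\<subseteq>{1..2*n}. c T - bd n b T \<in> I)))"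

definition graded_ideal :: "nat \<Rightarrow> 'k::field mpoly set \<Rightarrow> bool" where
  "graded_ideal n I \<longleftrightarrow> I \<subseteq> polyS n \<and> 0 \<in> I \<and> (\<forall>p\<in>I. \<forall>q\<in>I. p + q \<in> I) \<and>
     (\<forall>p\<in>I. \<forall>s\<in>polyS n. s * p \<in> I) \<and> (\<forall>p\<in>I. \<forall>e. hcomp e p \<in> I)"

lemma sg_square: "sg k T * sg k T = (1 :: 'k::field mpoly)"
proof -
  have "sg k T = (1 :: 'k mpoly) \<or> sg k T = (- 1 :: 'k mpoly)"
    unfolding sg_def by (cases "even (card {t \<in> T. t < k})") simp_all
  then show ?thesis by (elim disjE) simp_all
qed

lemma sg_insert:
  assumes "finite T" "l \<notin> T"
  shows "sg k (insert l T) = (if l < k then - sg k T else sg k T)"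
proof (cases "l < k")
  case True
  then have "{t \<in> insert l T. t < k} = insert l {t \<in> T. t < k}" by auto
  then show ?thesis using assms True by (simp add: sg_def)
next
  case False
  then have "{t \<in> insert l T. t < k} = {t \<in> T. t < k}" by auto
  then show ?thesis using False by (simp add: sg_def)
qed

lemma sg_swap:
  assumes "finite T" "k \<noteq> l" "k \<notin> T" "l \<notin> T"
  shows "sg k T * sg l (insert k T) = - (sg l T * sg k (insert l T))"
  using assms by (cases "k < l") (auto simp: sg_insert)

lemma polyS_sg [simp]: "sg k T \<in> polyS n"
  by (simp add: sg_def)

lemma homogeneous_sg: "homogeneous 0 (sg k T)"
  by (simp add: sg_def homogeneous_neg1_power)

text \<open>Exchanging the two sums would only give that the total equals its own negative, which is
  inconclusive in characteristic 2; the induction cancels the pairs directly.\<close>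

lemma sum_antisym:
  fixes F :: "'a \<Rightarrow> 'a \<Rightarrow> 'b::ab_group_add"
  assumes "finite A" "\<And>k l. k \<in> A \<Longrightarrow> l \<in> A \<Longrightarrow> k \<noteq> l \<Longrightarrow> F k l = - F l k"
  shows "(\<Sum>k\<in>A. \<Sum>l\<in>A - {k}. F k l) = 0"
  using assms
proof (induction A rule: finite_induct)
  case (insert a A)
  have "(\<Sum>l\<in>insert a A - {k}. F k l) = F k a + (\<Sum>l\<in>A - {k}. F k l)" if "k \<in> A" for k
  proof -
    have "insert a A - {k} = insert a (A - {k})" using that insert(2) by auto
    then show ?thesis using insert(1,2) that by simp
  qed
  moreover have "insert a A - {a} = A" using insert(2) by auto
  moreover have "(\<Sum>k\<in>A. \<Sum>l\<in>A - {k}. F k l) = 0" using insert(3,4) by blast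
  ultimately have "(\<Sum>k\<in>insert a A. \<Sum>l\<in>insert a A - {k}. F k l) =
      (\<Sum>l\<in>A. F a l) + (\<Sum>k\<in>A. F k a)"
    using insert(1,2) by (simp add: sum.distrib)
  also have "(\<Sum>k\<in>A. F k a) = (\<Sum>k\<in>A. - F a k)"
    by (rule sum.cong) (use insert(2,4) in blast)+
  finally show ?case by (simp add: sum_negf)
qed simp

lemma bd_bd:
  assumes "T \<subseteq> {1..2*n}"
  shows "bd n (bd n c) T = 0"
proof -
  have fin: "finite T" using assms finite_subset by blast
  let ?F = "\<lambda>k l. sg k T * var k * (sg l (insert k T) * var l * c (insert l (insert k T)))"
  have "bd n (bd n c) T = (\<Sum>k\<in>{1..2*n} - T. \<Sum>l\<in>({1..2*n} - T) - {k}. ?F k l)"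
    unfolding bd_def by (auto simp: sum_distrib_left intro!: sum.cong)
  also have "\<dots> = 0"
  proof (rule sum_antisym)
    fix k l assume kl: "k \<in> {1..2*n} - T" "l \<in> {1..2*n} - T" "k \<noteq> l"
    have "?F k l = (sg k T * sg l (insert k T)) * (var k * var l * c (insert k (insert l T)))"
      by (simp add: algebra_simps insert_commute)
    also have "sg k T * sg l (insert k T) = - (sg l T * sg k (insert l T) :: 'a mpoly)"
      using sg_swap[OF fin, of k l] kl by auto
    also have "\<dots> * (var k * var l * c (insert k (insert l T))) = - ?F l k"
      by (simp add: algebra_simps)
    finally show "?F k l = - ?F l k" .
  qed simp
  finally show ?thesis .
qed

lemma bd_cong:
  assumes "\<And>T. T \<subseteq> {1..2*n} \<Longrightarrow> c T = c' T" "T \<subseteq> {1..2*n}"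
  shows "bd n c T = bd n c' T"
  unfolding bd_def using assms by (intro sum.cong refl) auto

lemma bd_add: "bd n (\<lambda>T. a T + b T) T = bd n a T + bd n b T"
  by (simp add: bd_def algebra_simps sum.distrib)

lemma bd_diff: "bd n (\<lambda>T. a T - b T) T = bd n a T - bd n b T"
  by (simp add: bd_def algebra_simps sum_subtractf)

lemma bd_mult: "bd n (\<lambda>T. s * a T) T = s * bd n a T"
  by (simp add: bd_def algebra_simps sum_distrib_left)

text \<open>The homotopy formula: multiplication by a variable is null-homotopic on the Koszul
  complex. For \<open>z\<close> outside \<open>T\<close> only the summand \<open>k = z\<close>
  survives; for \<open>z\<close> in \<open>T\<close> the other summands cancel by the sign change of
  exchanged indices.\<close>

lemma bd_wedge:
  assumes T: "T \<subseteq> {1..2*n}" and z: "z \<in> {1..2*n}"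
  shows "bd n (wedge z c) T + wedge z (bd n c) T = var z * c T"
proof (cases "z \<in> T")
  case True
  define U where "U = T - {z}"
  have U: "T = insert z U" "z \<notin> U" "finite U" "U \<subseteq> {1..2*n}"
    using True T finite_subset[OF T] by (auto simp: U_def)
  have X: "{1..2*n} - U = insert z ({1..2*n} - T)" using z U by auto
  have "wedge z (bd n c) T = sg z U * (\<Sum>k\<in>{1..2*n} - U. sg k U * var k * c (insert k U))"
    using True by (simp add: wedge_def U_def bd_def)
  also have "\<dots> = (sg z U * sg z U) * var z * c T +
      (\<Sum>k\<in>{1..2*n} - T. sg z U * (sg k U * var k * c (insert k U)))"
    unfolding X using True U(1) by (simp add: algebra_simps sum_distrib_left)
  finally have 1: "wedge z (bd n c) T = var z * c T +
      (\<Sum>k\<in>{1..2*n} - T. sg z U * (sg k U * var k * c (insert k U)))"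
    by (simp add: sg_square)
  have "bd n (wedge z c) T = (\<Sum>k\<in>{1..2*n} - T. - (sg z U * (sg k U * var k * c (insert k U))))"
    unfolding bd_def
  proof (rule sum.cong)
    fix k assume k: "k \<in> {1..2*n} - T"
    then have "insert k T - {z} = insert k U" using U by auto
    then have "sg k T * var k * wedge z c (insert k T) =
        (sg z (insert k U) * sg k (insert z U)) * var k * c (insert k U)"
      using True U(1) by (simp add: wedge_def algebra_simps)
    also have "sg z (insert k U) * sg k (insert z U) = - (sg z U * sg k U :: 'a mpoly)"
      using k U by (cases "z < k") (auto simp: sg_insert)
    finally show "sg k T * var k * wedge z c (insert k T) = - (sg z U * (sg k U * var k * c (insert k U)))"
      by (simp add: algebra_simps)
  qed simp
  then show ?thesis using 1 by (simp add: sum_negf)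
next
  case False
  have "bd n (wedge z c) T = (\<Sum>k\<in>{z}. sg k T * var k * wedge z c (insert k T))"
    unfolding bd_def using z False by (intro sum.mono_neutral_right) (auto simp: wedge_def)
  also have "\<dots> = (sg z T * sg z T) * (var z * c T)"
    using False by (simp add: wedge_def algebra_simps)
  finally show ?thesis using False by (simp add: wedge_def sg_square)
qed

lemma chain_bd: "chain n e c \<Longrightarrow> chain n (Suc e) (bd n c)"
  unfolding chain_def bd_def
proof (intro allI impI conjI polyS_sum homogeneous_sum)
  fix T k assume c: "\<forall>T\<subseteq>{1..2*n}. c T \<in> polyS n \<and> homogeneous e (c T)"
    and T: "T \<subseteq> {1..2*n}" and k: "k \<in> {1..2*n} - T"
  then have *: "c (insert k T) \<in> polyS n" "homogeneous e (c (insert k T))" by auto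
  show "sg k T * var k * c (insert k T) \<in> polyS n" using * k by (intro polyS_mult) auto
  show "homogeneous (Suc e) (sg k T * var k * c (insert k T))"
    using homogeneous_mult[OF homogeneous_mult[OF homogeneous_sg homogeneous_var] *(2)] by simp
qed

lemma chain_wedge:
  assumes "chain n e c" shows "chain n e (wedge z c)"
  unfolding chain_def
proof (intro allI impI)
  fix T assume "T \<subseteq> {1..2*n}"
  then have "T - {z} \<subseteq> {1..2*n}" by blast
  then have *: "c (T - {z}) \<in> polyS n" "homogeneous e (c (T - {z}))"
    using assms unfolding chain_def by blast+
  then show "wedge z c T \<in> polyS n \<and> homogeneous e (wedge z c T)"
    using homogeneous_mult[OF homogeneous_sg *(2)] by (auto simp: wedge_def)
qed

lemma chain_add: "chain n e a \<Longrightarrow> chain n e b \<Longrightarrow> chain n e (\<lambda>T. a T + b T)"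
  by (auto simp: chain_def homogeneous_add)

lemma chain_diff: "chain n e a \<Longrightarrow> chain n e b \<Longrightarrow> chain n e (\<lambda>T. a T - b T)"
  by (auto simp: chain_def homogeneous_diff)

lemma chain_mult:
  assumes "chain n e a" "s \<in> polyS n" "homogeneous d s"
  shows "chain n (d + e) (\<lambda>T. s * a T)"
  using assms unfolding chain_def by (blast intro: homogeneous_mult)

lemma graded_idealD:
  assumes "graded_ideal n I"
  shows "p \<in> I \<Longrightarrow> p \<in> polyS n" "0 \<in> I" "p \<in> I \<Longrightarrow> q \<in> I \<Longrightarrow> p + q \<in> I"
    "p \<in> I \<Longrightarrow> s \<in> polyS n \<Longrightarrow> s * p \<in> I" "p \<in> I \<Longrightarrow> hcomp e p \<in> I"
  using assms by (auto simp: graded_ideal_def)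

lemma graded_ideal_uminus: "graded_ideal n I \<Longrightarrow> p \<in> I \<Longrightarrow> - p \<in> I"
  using graded_idealD(4)[of n I p "- 1"] polyS_uminus[OF polyS_1, of n] by simp

lemma graded_ideal_diff: "graded_ideal n I \<Longrightarrow> p \<in> I \<Longrightarrow> q \<in> I \<Longrightarrow> p - q \<in> I"
  using graded_idealD(3)[of n I p "- q"] graded_ideal_uminus[of n I q] by simp

lemma graded_ideal_sum: "graded_ideal n I \<Longrightarrow> (\<And>i. i \<in> A \<Longrightarrow> f i \<in> I) \<Longrightarrow> sum f A \<in> I"
  by (induction A rule: infinite_finite_induct) (auto intro: graded_idealD)

lemma bd_ideal:
  assumes "graded_ideal n I" "\<And>T. T \<subseteq> {1..2*n} \<Longrightarrow> c T \<in> I" "T \<subseteq> {1..2*n}"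
  shows "bd n c T \<in> I"
  unfolding bd_def using assms
  by (intro graded_ideal_sum) (auto intro!: graded_idealD(4) polyS_mult)

lemma wedge_ideal:
  assumes "graded_ideal n I" "\<And>T. T \<subseteq> {1..2*n} \<Longrightarrow> c T \<in> I" "T \<subseteq> {1..2*n}"
  shows "wedge z c T \<in> I"
proof -
  have "c (T - {z}) \<in> I" using assms(3) by (intro assms(2)) blast
  then show ?thesis unfolding wedge_def using graded_idealD(2,4)[OF assms(1)] by simp
qed

section \<open>Regularity along short exact sequences of quotients\<close>

lemma reg_leD:
  assumes "reg_le n I r" "r \<le> e" "chain n (Suc e) c" "\<And>T. T \<subseteq> {1..2*n} \<Longrightarrow> bd n c T \<in> I"
  obtains b where "chain n e b" "\<And>T. T \<subseteq> {1..2*n} \<Longrightarrow> c T - bd n b T \<in> I"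
  using assms unfolding reg_le_def by blast

lemma reg_le_mono: "reg_le n I r \<Longrightarrow> r \<le> s \<Longrightarrow> reg_le n I s"
  unfolding reg_le_def by (blast intro: order_trans)

text \<open>The long exact sequence for an intersection and a sum of two ideals. Its connecting map
  raises the coefficient degree by one, so the sum \<open>I3\<close> has to satisfy the smaller
  bound \<open>r\<close>.\<close>

lemma reg_le_mayer_vietoris:
  assumes I: "graded_ideal n I1" "graded_ideal n I2"
    and cap: "I = I1 \<inter> I2" and plus: "\<And>p. p \<in> I3 \<Longrightarrow> \<exists>p1\<in>I1. \<exists>p2\<in>I2. p = p1 + p2"
    and sub: "I1 \<subseteq> I3" "I2 \<subseteq> I3" "graded_ideal n I3"
    and r: "reg_le n I1 (Suc r)" "reg_le n I2 (Suc r)" "reg_le n I3 r"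
  shows "reg_le n I (Suc r)"
  unfolding reg_le_def
proof (intro allI impI)
  fix e c assume e: "Suc r \<le> e" and c: "chain n (Suc e) c" "\<forall>T\<subseteq>{1..2*n}. bd n c T \<in> I"
  obtain e' where e': "e = Suc e'" "r \<le> e'" using e by (cases e) auto
  obtain b1 where b1: "chain n e b1" "\<And>T. T \<subseteq> {1..2*n} \<Longrightarrow> c T - bd n b1 T \<in> I1"
    by (rule reg_leD[OF r(1) e c(1)]) (use c(2) cap in auto)
  obtain b2 where b2: "chain n e b2" "\<And>T. T \<subseteq> {1..2*n} \<Longrightarrow> c T - bd n b2 T \<in> I2"
    by (rule reg_leD[OF r(2) e c(1)]) (use c(2) cap in auto)
  have ch: "chain n (Suc e') (\<lambda>T. b1 T - b2 T)"
    using chain_diff[OF b1(1) b2(1)] e' by simp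
  have "bd n (\<lambda>T. b1 T - b2 T) T \<in> I3" if T: "T \<subseteq> {1..2*n}" for T
  proof -
    have "bd n (\<lambda>T. b1 T - b2 T) T = (c T - bd n b2 T) - (c T - bd n b1 T)"
      by (simp add: bd_diff)
    moreover have "c T - bd n b1 T \<in> I3" "c T - bd n b2 T \<in> I3"
      using b1(2)[OF T] b2(2)[OF T] sub by auto
    ultimately show ?thesis using graded_ideal_diff[OF sub(3)] by presburger
  qed
  then obtain a where a: "chain n e' a" "\<And>T. T \<subseteq> {1..2*n} \<Longrightarrow> (b1 T - b2 T) - bd n a T \<in> I3"
    using reg_leD[OF r(3) e'(2) ch] by blast
  \<comment> \<open>Splitting the difference as \<open>i1 + i2\<close> makes \<open>b1 - i1\<close>
    equal to \<open>b2 + bd a + i2\<close>, so a single chain bounds \<open>c\<close> modulo both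
    ideals.\<close>
  have "\<exists>i1 i2. T \<subseteq> {1..2*n} \<longrightarrow> i1 \<in> I1 \<and> i2 \<in> I2 \<and> homogeneous e i1 \<and> (b1 T - b2 T) - bd n a T = i1 + i2" for T
  proof (cases "T \<subseteq> {1..2*n}")
    case True
    then obtain p1 p2 where p: "p1 \<in> I1" "p2 \<in> I2" "(b1 T - b2 T) - bd n a T = p1 + p2"
      using a(2) plus by blast
    have "homogeneous e ((b1 T - b2 T) - bd n a T)"
      using chain_diff[OF ch chain_bd[OF a(1)]] True e' unfolding chain_def by auto
    then have "(b1 T - b2 T) - bd n a T = hcomp e p1 + hcomp e p2"
      by (metis hcomp_id hcomp_add p(3))
    then show ?thesis using p I graded_idealD(5) homogeneous_hcomp by blast
  qed auto
  then obtain i1 i2 where i: "\<And>T. T \<subseteq> {1..2*n} \<Longrightarrow> i1 T \<in> I1 \<and> i2 T \<in> I2 \<and> homogeneous e (i1 T)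
      \<and> (b1 T - b2 T) - bd n a T = i1 T + i2 T" by metis
  have "chain n e i1" unfolding chain_def using i I(1) graded_idealD(1) by blast
  then have ch': "chain n e (\<lambda>T. b1 T - i1 T)" using chain_diff b1(1) by blast
  have "c T - bd n (\<lambda>T. b1 T - i1 T) T \<in> I" if T: "T \<subseteq> {1..2*n}" for T
  proof -
    have "c T - bd n (\<lambda>T. b1 T - i1 T) T = (c T - bd n b1 T) + bd n i1 T"
      by (simp add: bd_diff)
    moreover have "bd n i1 T \<in> I1" using bd_ideal[OF I(1) _ T] i by blast
    ultimately have 1: "c T - bd n (\<lambda>T. b1 T - i1 T) T \<in> I1"
      using graded_idealD(3)[OF I(1)] b1(2)[OF T] by metis
    have "bd n (\<lambda>T. b1 T - i1 T) T = bd n (\<lambda>T. b2 T + (bd n a T + i2 T)) T"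
      by (rule bd_cong[OF _ T]) (use i in \<open>simp add: algebra_simps\<close>)
    also have "\<dots> = bd n b2 T + bd n i2 T" by (simp add: bd_add bd_bd[OF T])
    finally have "c T - bd n (\<lambda>T. b1 T - i1 T) T = (c T - bd n b2 T) - bd n i2 T" by simp
    moreover have "bd n i2 T \<in> I2" using bd_ideal[OF I(2) _ T] i by blast
    ultimately have "c T - bd n (\<lambda>T. b1 T - i1 T) T \<in> I2"
      using graded_ideal_diff[OF I(2) b2(2)[OF T]] by metis
    with 1 cap show ?thesis by simp
  qed
  then show "\<exists>b. chain n e b \<and> (\<forall>T\<subseteq>{1..2*n}. c T - bd n b T \<in> I)"
    using ch' by blast
qed

text \<open>Splits a chain with values in \<open>I + (f)\<close>; the cofactor of \<open>f\<close> can be taken homogeneous.\<close>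

lemma chain_split:
  assumes I: "graded_ideal n I" and f: "f \<in> polyS n" "homogeneous d f"
    and plus: "\<And>p. p \<in> I' \<Longrightarrow> \<exists>p1\<in>I. \<exists>a\<in>polyS n. p = p1 + f * a"
    and c: "chain n (d + e) c" "\<And>T. T \<subseteq> {1..2*n} \<Longrightarrow> c T \<in> I'"
  obtains a where "chain n e a" "\<And>T. T \<subseteq> {1..2*n} \<Longrightarrow> c T - f * a T \<in> I"
proof -
  have "\<exists>a. T \<subseteq> {1..2*n} \<longrightarrow> a \<in> polyS n \<and> homogeneous e a \<and> c T - f * a \<in> I" for T
  proof (cases "T \<subseteq> {1..2*n}")
    case True
    then obtain p a where p: "p \<in> I" "a \<in> polyS n" "c T = p + f * a" using plus c(2) by blast
    have "c T = hcomp (d + e) p + f * hcomp e a"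
      using c(1) True p(3) hcomp_mult[OF f(2)] by (metis hcomp_id hcomp_add chain_def)
    then have "c T - f * hcomp e a \<in> I" using graded_idealD(5)[OF I p(1)] by simp
    then show ?thesis using p homogeneous_hcomp by blast
  qed auto
  then obtain a where "\<And>T. T \<subseteq> {1..2*n} \<Longrightarrow> a T \<in> polyS n \<and> homogeneous e (a T) \<and> c T - f * a T \<in> I"
    by metis
  then show ?thesis by (intro that[of a]) (auto simp: chain_def)
qed

text \<open>Meant for \<open>I' = I + (z)\<close>. A cycle that bounds modulo \<open>I'\<close>
  leaves a remainder \<open>var z * a\<close>; as \<open>z\<close> is a nonzerodivisor,
  \<open>a\<close> is a cycle modulo \<open>I\<close>, and the homotopy formula makes the remainder
  a boundary modulo \<open>I\<close>.\<close>

lemma reg_le_nonzerodivisor: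
  assumes I: "graded_ideal n I" and z: "z \<in> {1..2*n}"
    and nzd: "\<And>p. p \<in> polyS n \<Longrightarrow> var z * p \<in> I \<Longrightarrow> p \<in> I"
    and plus: "\<And>p. p \<in> I' \<Longrightarrow> \<exists>p1\<in>I. \<exists>a\<in>polyS n. p = p1 + var z * a"
    and sub: "I \<subseteq> I'"
    and r: "reg_le n I' r"
  shows "reg_le n I r"
  unfolding reg_le_def
proof (intro allI impI)
  fix e c assume e: "r \<le> e" and c: "chain n (Suc e) c" "\<forall>T\<subseteq>{1..2*n}. bd n c T \<in> I"
  obtain b where b: "chain n e b" "\<And>T. T \<subseteq> {1..2*n} \<Longrightarrow> c T - bd n b T \<in> I'"
    by (rule reg_leD[OF r e c(1)]) (use c(2) sub in auto)
  have ch: "chain n (Suc 0 + e) (\<lambda>T. c T - bd n b T)"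
    using chain_diff[OF c(1) chain_bd[OF b(1)]] by simp
  obtain a where a: "chain n e a" "\<And>T. T \<subseteq> {1..2*n} \<Longrightarrow> c T - bd n b T - var z * a T \<in> I"
    by (rule chain_split[OF I polyS_var[OF z] homogeneous_var plus ch b(2)]) auto
  have bda: "bd n a T \<in> I" if T: "T \<subseteq> {1..2*n}" for T
  proof (rule nzd)
    show "bd n a T \<in> polyS n" using chain_bd[OF a(1)] T unfolding chain_def by blast
    have "var z * bd n a T = bd n c T - bd n (\<lambda>T. c T - bd n b T - var z * a T) T"
      by (simp add: bd_diff bd_bd[OF T] bd_mult)
    moreover have "bd n (\<lambda>T. c T - bd n b T - var z * a T) T \<in> I"
      by (rule bd_ideal[OF I a(2) T])
    ultimately show "var z * bd n a T \<in> I"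
      using graded_ideal_diff[OF I c(2)[rule_format, OF T]] by presburger
  qed
  have "c T - bd n (\<lambda>T. b T + wedge z a T) T \<in> I" if T: "T \<subseteq> {1..2*n}" for T
  proof -
    have eq: "c T - bd n (\<lambda>T. b T + wedge z a T) T = (c T - bd n b T - var z * a T) + wedge z (bd n a) T"
      using bd_wedge[OF T z, of a] by (simp add: bd_add algebra_simps)
    show ?thesis
      unfolding eq by (rule graded_idealD(3)[OF I a(2)[OF T] wedge_ideal[OF I bda T]])
  qed
  then show "\<exists>b. chain n e b \<and> (\<forall>T\<subseteq>{1..2*n}. c T - bd n b T \<in> I)"
    using chain_add[OF b(1) chain_wedge[OF a(1)]] by blast
qed

text \<open>From 0 -> (S/(I:z))(-1) -> S/I -> S/(I + (z)) -> 0, with \<open>K\<close> the colon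
  ideal: the twist raises the bound for \<open>K\<close> by one. The remainder \<open>a\<close> is
  now bounded modulo \<open>K\<close>, and the factor \<open>var z\<close> carries this back to
  \<open>I\<close>.\<close>

lemma reg_le_colon_var:
  assumes I: "graded_ideal n I" and z: "z \<in> {1..2*n}"
    and K: "\<And>p. p \<in> polyS n \<Longrightarrow> var z * p \<in> I \<longleftrightarrow> p \<in> K"
    and plus: "\<And>p. p \<in> I' \<Longrightarrow> \<exists>p1\<in>I. \<exists>a\<in>polyS n. p = p1 + var z * a"
    and sub: "I \<subseteq> I'" "K \<subseteq> polyS n"
    and r: "reg_le n K r" "reg_le n I' (Suc r)"
  shows "reg_le n I (Suc r)"
  unfolding reg_le_def
proof (intro allI impI)
  fix e c assume e: "Suc r \<le> e" and c: "chain n (Suc e) c" "\<forall>T\<subseteq>{1..2*n}. bd n c T \<in> I"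
  obtain e' where e': "e = Suc e'" "r \<le> e'" using e by (cases e) auto
  obtain b where b: "chain n e b" "\<And>T. T \<subseteq> {1..2*n} \<Longrightarrow> c T - bd n b T \<in> I'"
    by (rule reg_leD[OF r(2) e c(1)]) (use c(2) sub in auto)
  have ch: "chain n (Suc 0 + e) (\<lambda>T. c T - bd n b T)"
    using chain_diff[OF c(1) chain_bd[OF b(1)]] by simp
  obtain a where a: "chain n e a" "\<And>T. T \<subseteq> {1..2*n} \<Longrightarrow> c T - bd n b T - var z * a T \<in> I"
    by (rule chain_split[OF I polyS_var[OF z] homogeneous_var plus ch b(2)]) auto
  have bda: "bd n a T \<in> K" if T: "T \<subseteq> {1..2*n}" for T
  proof (rule iffD1[OF K])
    show "bd n a T \<in> polyS n" using chain_bd[OF a(1)] T unfolding chain_def by blast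
    have "var z * bd n a T = bd n c T - bd n (\<lambda>T. c T - bd n b T - var z * a T) T"
      by (simp add: bd_diff bd_bd[OF T] bd_mult)
    moreover have "bd n (\<lambda>T. c T - bd n b T - var z * a T) T \<in> I"
      by (rule bd_ideal[OF I a(2) T])
    ultimately show "var z * bd n a T \<in> I"
      using graded_ideal_diff[OF I c(2)[rule_format, OF T]] by presburger
  qed
  obtain g where g: "chain n e' g" "\<And>T. T \<subseteq> {1..2*n} \<Longrightarrow> a T - bd n g T \<in> K"
    using reg_leD[OF r(1) e'(2) a(1)[unfolded e'(1)] bda] by blast
  have "c T - bd n (\<lambda>T. b T + var z * g T) T \<in> I" if T: "T \<subseteq> {1..2*n}" for T
  proof -
    have "c T - bd n (\<lambda>T. b T + var z * g T) T = (c T - bd n b T - var z * a T) + var z * (a T - bd n g T)"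
      by (simp add: bd_add bd_mult algebra_simps)
    moreover have "var z * (a T - bd n g T) \<in> I" using K g(2)[OF T] sub(2) by blast
    ultimately show ?thesis using graded_idealD(3)[OF I a(2)[OF T]] by metis
  qed
  moreover have "chain n e (\<lambda>T. b T + var z * g T)"
    using chain_add[OF b(1)] chain_mult[OF g(1) polyS_var[OF z] homogeneous_var] e' by simp
  ultimately show "\<exists>b. chain n e b \<and> (\<forall>T\<subseteq>{1..2*n}. c T - bd n b T \<in> I)"
    by blast
qed

text \<open>If \<open>bd c = f * a\<close> modulo \<open>I\<close>, then \<open>a\<close> is a cycle
  modulo the colon ideal \<open>K\<close>; once \<open>a = bd g\<close> modulo \<open>K\<close>, the
  chain \<open>c - f * g\<close> is a cycle modulo \<open>I\<close>. Since \<open>g\<close> has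
  degree two less than \<open>c\<close>, the bound for \<open>K\<close> is one below the bound for
  \<open>I'\<close>.\<close>

lemma reg_le_add_quadric:
  assumes I: "graded_ideal n I" and f: "f \<in> polyS n" "homogeneous 2 f"
    and K: "\<And>p. p \<in> polyS n \<Longrightarrow> f * p \<in> I \<longleftrightarrow> p \<in> K"
    and plus: "\<And>p. p \<in> I' \<longleftrightarrow> (\<exists>p1\<in>I. \<exists>a\<in>polyS n. p = p1 + f * a)"
    and sub: "K \<subseteq> polyS n"
    and r: "reg_le n K r" "reg_le n I (Suc r)"
  shows "reg_le n I' (Suc r)"
  unfolding reg_le_def
proof (intro allI impI)
  fix e c assume e: "Suc r \<le> e" and c: "chain n (Suc e) c" "\<forall>T\<subseteq>{1..2*n}. bd n c T \<in> I'"
  obtain e' where e': "e = Suc e'" "r \<le> e'" using e by (cases e) auto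
  have ch: "chain n (2 + e) (bd n c)"
    using chain_bd[OF c(1)] by simp
  obtain a where a: "chain n e a" "\<And>T. T \<subseteq> {1..2*n} \<Longrightarrow> bd n c T - f * a T \<in> I"
    by (rule chain_split[OF I f _ ch, of I']) (use plus c(2) in auto)
  have bda: "bd n a T \<in> K" if T: "T \<subseteq> {1..2*n}" for T
  proof (rule iffD1[OF K])
    show "bd n a T \<in> polyS n" using chain_bd[OF a(1)] T unfolding chain_def by blast
    have "f * bd n a T = - bd n (\<lambda>T. bd n c T - f * a T) T"
      by (simp add: bd_diff bd_bd[OF T] bd_mult)
    moreover have "bd n (\<lambda>T. bd n c T - f * a T) T \<in> I"
      by (rule bd_ideal[OF I a(2) T])
    ultimately show "f * bd n a T \<in> I" using graded_ideal_uminus[OF I] by metis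
  qed
  obtain g where g: "chain n e' g" "\<And>T. T \<subseteq> {1..2*n} \<Longrightarrow> a T - bd n g T \<in> K"
    using reg_leD[OF r(1) e'(2) a(1)[unfolded e'(1)] bda] by blast
  have ch': "chain n (Suc e) (\<lambda>T. c T - f * g T)"
    using chain_diff[OF c(1)] chain_mult[OF g(1) f] e' by simp
  have "bd n (\<lambda>T. c T - f * g T) T \<in> I" if T: "T \<subseteq> {1..2*n}" for T
  proof -
    have "bd n (\<lambda>T. c T - f * g T) T = (bd n c T - f * a T) + f * (a T - bd n g T)"
      by (simp add: bd_diff bd_mult algebra_simps)
    moreover have "f * (a T - bd n g T) \<in> I" using K g(2)[OF T] sub by blast
    ultimately show ?thesis using graded_idealD(3)[OF I a(2)[OF T]] by metis
  qed
  then obtain b where b: "chain n e b" "\<And>T. T \<subseteq> {1..2*n} \<Longrightarrow> c T - f * g T - bd n b T \<in> I"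
    using reg_leD[OF r(2) e ch'] by blast
  have "c T - bd n b T \<in> I'" if T: "T \<subseteq> {1..2*n}" for T
  proof -
    have "c T - bd n b T = (c T - f * g T - bd n b T) + f * g T" by simp
    moreover have "g T \<in> polyS n" using g(1) T unfolding chain_def by blast
    ultimately show ?thesis using plus b(2)[OF T] by blast
  qed
  then show "\<exists>b. chain n e b \<and> (\<forall>T\<subseteq>{1..2*n}. c T - bd n b T \<in> I')"
    using b(1) by blast
qed

section \<open>Ideals given by generators\<close>

inductive_set idl :: "nat \<Rightarrow> 'k::field mpoly set \<Rightarrow> 'k mpoly set" for n G where
  zero: "0 \<in> idl n G"
| step: "s \<in> polyS n \<Longrightarrow> g \<in> G \<Longrightarrow> q \<in> idl n G \<Longrightarrow> s * g + q \<in> idl n G"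

lemma idl_mult_gen: "s \<in> polyS n \<Longrightarrow> g \<in> G \<Longrightarrow> s * g \<in> idl n G"
  using idl.step[OF _ _ idl.zero] by fastforce

lemma idl_gen: "g \<in> G \<Longrightarrow> g \<in> idl n G"
  using idl_mult_gen[OF polyS_1] by fastforce

lemma idl_add: "p \<in> idl n G \<Longrightarrow> q \<in> idl n G \<Longrightarrow> p + q \<in> idl n G"
proof (induction rule: idl.induct)
  case (step s g p)
  then show ?case using idl.step[of s n g G "p + q"] by (simp add: add.assoc)
qed simp

lemma idl_mult:
  assumes "s \<in> polyS n" shows "p \<in> idl n G \<Longrightarrow> s * p \<in> idl n G"
proof (induction rule: idl.induct)
  case (step t g p)
  have "s * (t * g + p) = (s * t) * g + s * p" by (simp add: algebra_simps)
  then show ?case using idl.step[of "s * t" n g G "s * p"] step assms by auto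
qed (simp add: idl.zero)

lemma idl_gens: "G \<subseteq> idl n G"
  by (auto intro: idl_gen)

lemma idl_sum: "(\<And>i. i \<in> A \<Longrightarrow> f i \<in> idl n G) \<Longrightarrow> sum f A \<in> idl n G"
  by (induction A rule: infinite_finite_induct) (auto intro: idl_add idl.zero)

lemma idl_uminus: "g \<in> idl n G \<Longrightarrow> - g \<in> idl n G"
  using idl_mult[OF polyS_uminus[OF polyS_1]] by fastforce

text \<open>Only additivity of \<open>h\<close> is assumed, because it is applied to maps such as
  the difference of the identity and \<open>kill B\<close>, which are not linear over
  \<open>S\<close>.\<close>

lemma idl_map:
  assumes I: "graded_ideal n I" and h: "h 0 = 0" "\<And>p q. h (p + q) = h p + h q"
    "\<And>s g. s \<in> polyS n \<Longrightarrow> g \<in> G \<Longrightarrow> h (s * g) \<in> I"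
  shows "p \<in> idl n G \<Longrightarrow> h p \<in> I"
  by (induction rule: idl.induct) (auto simp: h graded_idealD[OF I])

lemma graded_ideal_idl:
  assumes "\<And>g. g \<in> G \<Longrightarrow> g \<in> polyS n" and hom: "\<And>g. g \<in> G \<Longrightarrow> \<exists>d. homogeneous d g"
  shows "graded_ideal n (idl n G)"
  unfolding graded_ideal_def
proof (intro conjI ballI allI)
  show "idl n G \<subseteq> polyS n"
  proof
    fix p assume "p \<in> idl n G"
    then show "p \<in> polyS n" by induction (use assms(1) in auto)
  qed
next
  fix p e assume "p \<in> idl n G"
  then show "hcomp e p \<in> idl n G"
  proof induction
    case zero then show ?case by (simp add: hcomp_def idl.zero)
  next
    case (step s g q)
    obtain d where d: "homogeneous d g" using hom step by blast
    have "hcomp e (g * s) \<in> idl n G"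
    proof (cases "d \<le> e")
      case True
      then have "hcomp e (g * s) = hcomp (e - d) s * g"
        using hcomp_mult[OF d, of "e - d" s] by (simp add: mult.commute)
      then show ?thesis using step by (auto intro: idl_mult_gen)
    next
      case False
      then show ?thesis using hcomp_mult_0[OF d] idl.zero by simp
    qed
    then show ?case using step idl_add by (simp add: hcomp_add mult.commute)
  qed
qed (auto intro: idl.zero idl_add idl_mult)

lemma idl_mono:
  assumes "G \<subseteq> idl n G'" shows "idl n G \<subseteq> idl n G'"
proof
  fix p assume "p \<in> idl n G"
  then show "p \<in> idl n G'"
    by induction (use assms in \<open>auto intro: idl.zero idl_add idl_mult\<close>)
qed

lemma idl_Un: "p \<in> idl n (G \<union> G') \<Longrightarrow> \<exists>p1\<in>idl n G. \<exists>p2\<in>idl n G'. p = p1 + p2"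
proof (induction rule: idl.induct)
  case zero
  then show ?case using idl.zero by force
next
  case (step s g q)
  then obtain p1 p2 where p: "p1 \<in> idl n G" "p2 \<in> idl n G'" "q = p1 + p2" by blast
  show ?case
  proof (cases "g \<in> G")
    case True
    then have "s * g + p1 \<in> idl n G" using step p idl.step by blast
    then show ?thesis using p by (metis add.assoc)
  next
    case False
    then have "s * g + p2 \<in> idl n G'" using step p idl.step by blast
    then show ?thesis using p by (metis add.left_commute)
  qed
qed

lemma idl_singleton: "p \<in> idl n {g} \<Longrightarrow> \<exists>a\<in>polyS n. p = g * a"
proof (induction rule: idl.induct)
  case zero
  then show ?case by (intro bexI[of _ 0]) auto
next
  case (step s g' q)
  then obtain a where "a \<in> polyS n" "q = g * a" by blast
  then show ?case using step by (intro bexI[of _ "s + a"]) (auto simp: algebra_simps)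
qed

lemma idl_insert: "p \<in> idl n (insert g G) \<Longrightarrow> \<exists>p1\<in>idl n G. \<exists>a\<in>polyS n. p = p1 + g * a"
  using idl_Un[of p n G "{g}"] idl_singleton by fastforce

lemma idl_insert_iff: "p \<in> idl n (insert g G) \<longleftrightarrow> (\<exists>p1\<in>idl n G. \<exists>a\<in>polyS n. p = p1 + g * a)"
proof
  assume "\<exists>p1\<in>idl n G. \<exists>a\<in>polyS n. p = p1 + g * a"
  then obtain p1 a where "p1 \<in> idl n G" "a \<in> polyS n" "p = a * g + p1"
    by (auto simp: algebra_simps)
  moreover have "idl n G \<subseteq> idl n (insert g G)" by (intro idl_mono) (auto intro: idl_gen)
  ultimately show "p \<in> idl n (insert g G)" by (auto intro: idl.step)
qed (rule idl_insert)

section \<open>Setting variables to zero, and variables as nonzerodivisors\<close>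

definition kill :: "nat set \<Rightarrow> 'k::field mpoly \<Rightarrow> 'k mpoly" where
  "kill B = pfilter (\<lambda>m. Poly_Mapping.keys m \<inter> B = {})"

lemma kill_0 [simp]: "kill B 0 = 0"
  by (simp add: kill_def)

lemma kill_add: "kill B (p + q) = kill B p + kill B q"
  by (simp add: kill_def pfilter_add)

lemma kill_diff: "kill B (p - q) = kill B p - kill B q"
  by (simp add: kill_def pfilter_diff)

text \<open>Every monomial of \<open>p - kill B p\<close> meets \<open>B\<close>, hence so does
  every monomial of its product with \<open>q\<close>, and the filter leaves nothing of it.\<close>

lemma kill_mult: "kill B (p * q) = kill B p * kill B q"
proof -
  let ?P = "\<lambda>m. Poly_Mapping.keys m \<inter> B = {}"
  have "p = kill B p + (p - kill B p)" by simp
  then have "kill B (p * q) = kill B (kill B p * q) + kill B ((p - kill B p) * q)"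
    by (metis distrib_right kill_add)
  also have "kill B (kill B p * q) = kill B p * kill B q"
    unfolding kill_def by (rule pfilter_mult) (auto simp: keys_pfilter keys_mon_add)
  also have "kill B ((p - kill B p) * q) = (p - kill B p) * pfilter (\<lambda>_. False) q"
    unfolding kill_def
    by (rule pfilter_mult) (auto simp: in_keys_iff lookup_minus lookup_pfilter keys_mon_add split: if_splits)
  also have "pfilter (\<lambda>_. False) q = 0" by (rule pfilter_none) auto
  finally show ?thesis by simp
qed

lemma kill_var: "kill B (var k) = (if k \<in> B then 0 else var k)"
  by (auto simp: kill_def var_def pfilter_single)

lemma polyS_kill [intro]: "p \<in> polyS n \<Longrightarrow> kill B p \<in> polyS n"
  by (auto simp: kill_def)

lemma kill_diff_mem:
  assumes "p \<in> polyS n" shows "p - kill B p \<in> idl n (var ` B)"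
proof -
  \<comment> \<open>\<open>B\<close> may contain indices of variables outside \<open>S\<close>;
    these cannot occur in \<open>p\<close>, and without them the ideal is graded.\<close>
  have "graded_ideal n (idl n (var ` (B \<inter> {1..2*n}) :: 'a mpoly set))"
    by (rule graded_ideal_idl) (auto intro: homogeneous_var)
  moreover have "Poly_Mapping.single m a \<in> idl n (var ` (B \<inter> {1..2*n}))"
    if m: "m \<in> Poly_Mapping.keys (p - kill B p)" for m and a :: 'a
  proof -
    from m have m': "Poly_Mapping.keys m \<inter> B \<noteq> {}" "m \<in> Poly_Mapping.keys p"
      by (auto simp: kill_def in_keys_iff lookup_minus lookup_pfilter split: if_splits)
    then have X: "Poly_Mapping.keys m \<subseteq> {1..2*n}" using assms by (auto simp: polyS_def)
    from m' obtain z where z: "z \<in> Poly_Mapping.keys m" "z \<in> B" by blast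
    have "m = (m - Poly_Mapping.single z 1) + Poly_Mapping.single z 1"
      using z by (intro poly_mapping_eqI)
        (auto simp: lookup_add lookup_minus lookup_single when_def in_keys_iff)
    then have "Poly_Mapping.single m a = Poly_Mapping.single (m - Poly_Mapping.single z 1) a * var z"
      by (metis var_def mult_single mult.right_neutral)
    moreover have "Poly_Mapping.single (m - Poly_Mapping.single z 1) a \<in> polyS n"
      using X by (intro polyS_single) (auto simp: in_keys_iff lookup_minus)
    moreover have "var z \<in> (var ` (B \<inter> {1..2*n}) :: 'a mpoly set)" using z X by blast
    ultimately show ?thesis by (simp only: idl_mult_gen)
  qed
  ultimately have "p - kill B p \<in> idl n (var ` (B \<inter> {1..2*n}))"
    by (subst pm_expand) (rule graded_ideal_sum, auto)
  moreover have "idl n (var ` (B \<inter> {1..2*n})) \<subseteq> idl n (var ` B :: 'a mpoly set)"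
    by (rule idl_mono) (auto intro: idl_gen)
  ultimately show ?thesis by blast
qed

lemma kill_split:
  assumes "p \<in> polyS n" shows "\<exists>a\<in>polyS n. p = kill {z} p + var z * a"
  using idl_singleton[of "p - kill {z} p" n "var z"] kill_diff_mem[OF assms, of "{z}"]
  by (auto simp: algebra_simps)

lemma var_nonzero [simp]: "var k \<noteq> 0"
proof
  assume "var k = (0 :: 'a mpoly)"
  then have "Poly_Mapping.lookup (var k :: 'a mpoly) (Poly_Mapping.single k 1) = 0" by simp
  then show False by (simp add: var_def)
qed

text \<open>By induction every member \<open>q\<close> is \<open>kill {z} q + var z * a\<close> with
  \<open>a\<close> again a member; for \<open>q = var z * p\<close> the killed part vanishes and
  \<open>a = p\<close>.\<close>

lemma nonzerodivisor_free_var: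
  assumes G: "\<And>g. g \<in> G \<Longrightarrow> kill {z} g = g"
    and p: "var z * p \<in> idl n G"
  shows "p \<in> idl n G"
proof -
  have "\<exists>a\<in>idl n G. q = kill {z} q + var z * a" if "q \<in> idl n G" for q
    using that
  proof induction
    case zero
    then show ?case using idl.zero by force
  next
    case (step s g q)
    obtain a where a: "a \<in> polyS n" "s = kill {z} s + var z * a" using kill_split step by blast
    obtain b where b: "b \<in> idl n G" "q = kill {z} q + var z * b" using step by blast
    have "s * g + q = (kill {z} s * g + kill {z} q) + var z * (a * g + b)"
      by (subst a(2), subst b(2)) (simp add: algebra_simps)
    also have "kill {z} s * g + kill {z} q = kill {z} (s * g + q)"
      by (simp add: kill_add kill_mult G step)
    finally show ?case using idl.step[OF a(1) step(2) b(1)] by blast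
  qed
  from this[OF p] obtain a where "a \<in> idl n G" "var z * p = var z * a"
    by (auto simp: kill_mult kill_var)
  then show ?thesis by simp
qed

text \<open>Descending induction from the set of all variables, modulo which no coefficient of
  positive degree survives; each variable taken out of \<open>B\<close> is a nonzerodivisor modulo
  the remaining ones. For empty \<open>B\<close> this is exactness of the Koszul complex of
  \<open>S\<close> in positive coefficient degree.\<close>

lemma reg_le_vars:
  assumes "B \<subseteq> {1..2*n}" shows "reg_le n (idl n (var ` B :: 'k::field mpoly set)) 0"
  using assms
proof (induction "card ({1..2*n} - B)" arbitrary: B)
  case 0
  then have B: "B = {1..2*n}" by auto
  show ?case unfolding reg_le_def
  proof (intro allI impI)
    fix e and c :: "nat set \<Rightarrow> 'k mpoly" assume c: "chain n (Suc e) c"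
    have "c T \<in> idl n (var ` B)" if "T \<subseteq> {1..2*n}" for T
    proof -
      have cT: "c T \<in> polyS n" "homogeneous (Suc e) (c T)" using c that by (auto simp: chain_def)
      have "Poly_Mapping.keys m \<inter> B \<noteq> {}" if "m \<in> Poly_Mapping.keys (c T)" for m
      proof -
        have "mon_deg m = Suc e" "Poly_Mapping.keys m \<subseteq> B"
          using that cT B by (auto simp: homogeneous_def polyS_def)
        then show ?thesis by (metis Int_absorb2 keys_eq_empty mon_deg_0 nat.distinct(1))
      qed
      then have "kill B (c T) = 0" unfolding kill_def by (intro pfilter_none) auto
      then show ?thesis using kill_diff_mem[OF cT(1), of B] by simp
    qed
    then show "\<exists>b. chain n e b \<and> (\<forall>T\<subseteq>{1..2*n}. c T - bd n b T \<in> idl n (var ` B))"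
      by (intro exI[of _ "\<lambda>_. 0"]) (auto simp: chain_def bd_def)
  qed
next
  case (Suc k)
  then have "{1..2*n} - B \<noteq> {}" by force
  then obtain z where z: "z \<in> {1..2*n}" "z \<notin> B" by blast
  have "card (insert z ({1..2*n} - insert z B)) = Suc k"
    unfolding Suc(2) by (rule arg_cong[of _ _ card]) (use z in auto)
  then have "card ({1..2*n} - insert z B) = k" by simp
  then have r: "reg_le n (idl n (insert (var z) (var ` B) :: 'k mpoly set)) 0"
    using Suc(1)[of "insert z B"] Suc(3) z by simp
  show ?case
  proof (rule reg_le_nonzerodivisor[OF _ z(1) _ _ _ r])
    show "graded_ideal n (idl n (var ` B :: 'k mpoly set))"
      by (intro graded_ideal_idl) (use Suc(3) polyS_var homogeneous_var in blast)+
    show "p \<in> idl n (var ` B)" if "var z * p \<in> idl n (var ` B)" for p :: "'k mpoly"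
      by (rule nonzerodivisor_free_var[OF _ that]) (use z in \<open>auto simp: kill_var\<close>)
    show "idl n (var ` B) \<subseteq> idl n (insert (var z) (var ` B) :: 'k mpoly set)"
      by (rule idl_mono) (auto intro: idl_gen)
  qed (rule idl_insert)
qed

section \<open>Minimal resolutions and Koszul homology\<close>

lemma bd_sum: "bd n (\<lambda>T. \<Sum>k\<in>K. f k T) T = (\<Sum>k\<in>K. bd n (f k) T)"
  by (induction K rule: infinite_finite_induct) (simp_all add: bd_add bd_def[of n "\<lambda>T. 0"])

lemma bd_zero [simp]: "bd n (\<lambda>T. 0) T = 0"
  by (simp add: bd_def)

lemma koszul_exact:
  assumes c: "chain n (Suc e) c" "\<And>T. T \<subseteq> {1..2*n} \<Longrightarrow> bd n c T = 0"
  obtains b where "chain n e b" "\<And>T. T \<subseteq> {1..2*n} \<Longrightarrow> c T = bd n b T"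
proof -
  have 0: "p = 0" if "p \<in> idl n {}" for p :: "'a mpoly"
    using that by cases auto
  have "reg_le n (idl n {} :: 'a mpoly set) 0" using reg_le_vars[of "{}" n] by simp
  then obtain b where b: "chain n e b" "\<And>T. T \<subseteq> {1..2*n} \<Longrightarrow> c T - bd n b T \<in> idl n {}"
    by (rule reg_leD[OF _ le0 c(1)]) (simp_all only: c(2) idl.zero)
  have "c T = bd n b T" if "T \<subseteq> {1..2*n}" for T
    using 0[OF b(2)[OF that]] by simp
  then show ?thesis by (rule that[OF b(1)])
qed

locale koszul_resolution =
  fixes n :: nat and I :: "'k::field mpoly set" and b :: "nat \<Rightarrow> nat"
    and d :: "nat \<Rightarrow> nat \<Rightarrow> nat" and A :: "nat \<Rightarrow> nat \<Rightarrow> nat \<Rightarrow> 'k mpoly" and r :: nat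
  assumes reg: "reg_le n I r" and res: "min_graded_free_res n I b d A"
begin

text \<open>The elements of degree \<open>e\<close> in the graded module \<open>F_i\<close>.
  Components at generators of larger degree must be forced to vanish, since truncated subtraction
  would allow constants there.\<close>

definition hvec :: "nat \<Rightarrow> nat \<Rightarrow> (nat \<Rightarrow> 'k mpoly) \<Rightarrow> bool" where
  "hvec i e v \<longleftrightarrow> v \<in> free_mod n (b i) \<and>
     (\<forall>k<b i. if d i k \<le> e then homogeneous (e - d i k) (v k) else v k = 0)"

definition vbd :: "(nat set \<Rightarrow> nat \<Rightarrow> 'k mpoly) \<Rightarrow> nat set \<Rightarrow> nat \<Rightarrow> 'k mpoly" where
  "vbd C T = (\<lambda>k. bd n (\<lambda>U. C U k) T)"

text \<open>By exactness this is \<open>I\<close> for \<open>i = 0\<close> and the kernel of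
  \<open>F_i -> F_(i-1)\<close> for larger \<open>i\<close>.\<close>

definition syz :: "nat \<Rightarrow> (nat \<Rightarrow> 'k mpoly) set" where
  "syz i = res_map b A (Suc i) ` free_mod n (b (Suc i))"

lemma b_0: "b 0 = 1" and d_0: "d 0 0 = 0"
  using res unfolding min_graded_free_res_def by (rule conjunct1, rule conjunct1[OF conjunct2])

lemma entry: "l < b i \<Longrightarrow> k < b (Suc i) \<Longrightarrow> A (Suc i) l k \<in> polyS n"
  "l < b i \<Longrightarrow> k < b (Suc i) \<Longrightarrow> A (Suc i) l k \<noteq> 0 \<Longrightarrow> d i l < d (Suc i) k"
  "l < b i \<Longrightarrow> k < b (Suc i) \<Longrightarrow> A (Suc i) l k \<noteq> 0 \<Longrightarrow>
     homogeneous (d (Suc i) k - d i l) (A (Suc i) l k)"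
proof -
  have "\<forall>i\<ge>1. \<forall>l<b (i - 1). \<forall>k<b i. A i l k \<in> polyS n \<and>
        (A i l k \<noteq> 0 \<longrightarrow> d (i - 1) l < d i k \<and> homogeneous (d i k - d (i - 1) l) (A i l k))"
    using res unfolding min_graded_free_res_def by (elim conjE)
  then have "\<forall>l<b i. \<forall>k<b (Suc i). A (Suc i) l k \<in> polyS n \<and>
        (A (Suc i) l k \<noteq> 0 \<longrightarrow> d i l < d (Suc i) k \<and>
          homogeneous (d (Suc i) k - d i l) (A (Suc i) l k))"
    by (metis diff_Suc_1 le_add1 plus_1_eq_Suc)
  then show "l < b i \<Longrightarrow> k < b (Suc i) \<Longrightarrow> A (Suc i) l k \<in> polyS n"
  "l < b i \<Longrightarrow> k < b (Suc i) \<Longrightarrow> A (Suc i) l k \<noteq> 0 \<Longrightarrow> d i l < d (Suc i) k"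
  "l < b i \<Longrightarrow> k < b (Suc i) \<Longrightarrow> A (Suc i) l k \<noteq> 0 \<Longrightarrow>
     homogeneous (d (Suc i) k - d i l) (A (Suc i) l k)" by blast+
qed

lemma syz_0: "syz 0 = {v \<in> free_mod n 1. v 0 \<in> I}"
  using res by (simp add: min_graded_free_res_def syz_def)

lemma syz_Suc: "syz (Suc i) = {v \<in> free_mod n (b (Suc i)). res_map b A (Suc i) v = (\<lambda>_. 0)}"
  using res unfolding min_graded_free_res_def syz_def by simp

lemma hvecD: "hvec i e v \<Longrightarrow> k < b i \<Longrightarrow> d i k \<le> e \<Longrightarrow> homogeneous (e - d i k) (v k)"
  "hvec i e v \<Longrightarrow> k < b i \<Longrightarrow> e < d i k \<Longrightarrow> v k = 0"
  "hvec i e v \<Longrightarrow> b i \<le> k \<Longrightarrow> v k = 0"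
  "hvec i e v \<Longrightarrow> k < b i \<Longrightarrow> v k \<in> polyS n"
  by (auto simp: hvec_def free_mod_def dest: leD)

lemma hvec_diff: "hvec i e v \<Longrightarrow> hvec i e w \<Longrightarrow> hvec i e (\<lambda>k. v k - w k)"
  by (auto simp: hvec_def free_mod_def homogeneous_diff)

lemma hvec_vbd:
  assumes "\<And>T. T \<subseteq> {1..2*n} \<Longrightarrow> hvec i e (C T)" "T \<subseteq> {1..2*n}"
  shows "hvec i (Suc e) (vbd C T)"
proof -
  have "bd n (\<lambda>U. C U k) T \<in> polyS n \<and> (if d i k \<le> Suc e
      then homogeneous (Suc e - d i k) (bd n (\<lambda>U. C U k) T) else bd n (\<lambda>U. C U k) T = 0)"
    if k: "k < b i" for k
  proof (cases "d i k \<le> e")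
    case True
    then have "chain n (e - d i k) (\<lambda>U. C U k)"
      using hvecD(1,4)[OF assms(1) k] by (simp add: chain_def)
    from chain_bd[OF this] True assms(2) show ?thesis
      by (simp add: chain_def Suc_diff_le)
  next
    case False
    then have "bd n (\<lambda>U. C U k) T = bd n (\<lambda>U. 0) T"
      using hvecD(2)[OF assms(1) k] by (intro bd_cong assms(2)) auto
    then show ?thesis by simp
  qed
  moreover have "bd n (\<lambda>U. C U k) T = 0" if k: "b i \<le> k" for k
  proof -
    have "bd n (\<lambda>U. C U k) T = bd n (\<lambda>U. 0) T"
      using hvecD(3)[OF assms(1) k] by (intro bd_cong assms(2)) auto
    then show ?thesis by simp
  qed
  ultimately show ?thesis by (simp add: hvec_def vbd_def free_mod_def)
qed

lemma res_map_vbd: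
  "res_map b A (Suc i) (vbd C T) = vbd (\<lambda>U. res_map b A (Suc i) (C U)) T"
  by (rule ext) (simp add: res_map_def vbd_def bd_sum bd_mult)

lemma res_map_diff:
  "res_map b A (Suc i) (\<lambda>k. v k - w k) = (\<lambda>k. res_map b A (Suc i) v k - res_map b A (Suc i) w k)"
  by (rule ext) (simp add: res_map_def algebra_simps sum_subtractf)

text \<open>Minimality enters here: nonzero matrix entries have positive degree, so a component of
  degree zero receives no contribution.\<close>

lemma summand:
  assumes v: "hvec (Suc i) e v" and lk: "l < b i" "k < b (Suc i)"
  shows "if d i l \<le> e then homogeneous (e - d i l) (A (Suc i) l k * v k) else A (Suc i) l k * v k = 0"
    and "d i l = e \<Longrightarrow> A (Suc i) l k * v k = 0"
proof -
  have "A (Suc i) l k * v k = 0 \<or>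
      (d i l < e \<and> homogeneous (e - d i l) (A (Suc i) l k * v k))"
  proof (rule disjCI)
    assume "\<not> (d i l < e \<and> homogeneous (e - d i l) (A (Suc i) l k * v k))"
    moreover have "d i l < e \<and> homogeneous (e - d i l) (A (Suc i) l k * v k)"
      if "A (Suc i) l k * v k \<noteq> 0"
    proof -
    from that have nz: "A (Suc i) l k \<noteq> 0" "v k \<noteq> 0" by auto
    then have ke: "d (Suc i) k \<le> e" using hvecD(2)[OF v lk(2)] by force
    have "(d (Suc i) k - d i l) + (e - d (Suc i) k) = e - d i l"
      using ke entry(2)[OF lk nz(1)] by simp
    then show ?thesis
      using homogeneous_mult[OF entry(3)[OF lk nz(1)] hvecD(1)[OF v lk(2) ke]]
        ke entry(2)[OF lk nz(1)] by simp
    qed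
    ultimately show "A (Suc i) l k * v k = 0" by blast
  qed
  then show "if d i l \<le> e then homogeneous (e - d i l) (A (Suc i) l k * v k) else A (Suc i) l k * v k = 0"
    "d i l = e \<Longrightarrow> A (Suc i) l k * v k = 0" by auto
qed

lemma hvec_res_map:
  assumes v: "hvec (Suc i) e v"
  shows "hvec i e (res_map b A (Suc i) v)"
    and "l < b i \<Longrightarrow> d i l = e \<Longrightarrow> res_map b A (Suc i) v l = 0"
proof -
  have "res_map b A (Suc i) v l \<in> polyS n" if "l < b i" for l
    using that hvecD(4)[OF v] entry(1) by (auto simp: res_map_def intro!: polyS_sum polyS_mult)
  moreover have "if d i l \<le> e then homogeneous (e - d i l) (res_map b A (Suc i) v l)
      else res_map b A (Suc i) v l = 0" if "l < b i" for l
    using summand(1)[OF v that] that by (auto simp: res_map_def intro!: homogeneous_sum sum.neutral)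
  moreover have "res_map b A (Suc i) v l = 0" if "b i \<le> l" for l
    using that by (simp add: res_map_def)
  ultimately show "hvec i e (res_map b A (Suc i) v)"
    unfolding hvec_def free_mod_def by blast
  show "l < b i \<Longrightarrow> d i l = e \<Longrightarrow> res_map b A (Suc i) v l = 0"
    using summand(2)[OF v] by (auto simp: res_map_def intro!: sum.neutral)
qed

text \<open>Any lift becomes homogeneous when each component is replaced by its part of the required
  degree, because the matrix entries are homogeneous.\<close>

lemma homogeneous_lift:
  assumes g: "hvec i e g" "g \<in> syz i"
  obtains w where "hvec (Suc i) e w" "res_map b A (Suc i) w = g"
proof -
  obtain w where w: "w \<in> free_mod n (b (Suc i))" "g = res_map b A (Suc i) w"
    using g(2) by (auto simp: syz_def)
  define w' where "w' = (\<lambda>k. if d (Suc i) k \<le> e then hcomp (e - d (Suc i) k) (w k) else 0)"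
  have w': "hvec (Suc i) e w'"
    using w(1) by (auto simp: hvec_def free_mod_def w'_def homogeneous_hcomp polyS_hcomp hcomp_0)
  have "res_map b A (Suc i) w' l = g l" if l: "l < b i" for l
  proof (cases "d i l \<le> e")
    case True
    have "A (Suc i) l k * w' k = hcomp (e - d i l) (A (Suc i) l k * w k)" if k: "k < b (Suc i)" for k
    proof (cases "A (Suc i) l k = 0")
      case nz: False
      show ?thesis
      proof (cases "d (Suc i) k \<le> e")
        case True
        then have "e - d i l = (d (Suc i) k - d i l) + (e - d (Suc i) k)"
          using entry(2)[OF l k nz] by simp
        then have "hcomp (e - d i l) (A (Suc i) l k * w k) =
            A (Suc i) l k * hcomp (e - d (Suc i) k) (w k)"
          using hcomp_mult[OF entry(3)[OF l k nz], of "e - d (Suc i) k" "w k"] by (simp only:)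
        then show ?thesis using True by (simp add: w'_def)
      next
        case False
        then have "hcomp (e - d i l) (A (Suc i) l k * w k) = 0"
          using entry(2)[OF l k nz] \<open>d i l \<le> e\<close>
          by (intro hcomp_mult_0[OF entry(3)[OF l k nz]]) linarith
        then show ?thesis using False by (simp add: w'_def)
      qed
    qed (simp add: hcomp_def)
    then have "res_map b A (Suc i) w' l = hcomp (e - d i l) (g l)"
      using l w(2) by (simp add: res_map_def hcomp_sum)
    then show ?thesis using hcomp_id[OF hvecD(1)[OF g(1) l True]] by simp
  next
    case False
    then have "g l = 0" using hvecD(2)[OF g(1) l] by simp
    then show ?thesis using hvecD(2)[OF hvec_res_map(1)[OF w'] l] False by simp
  qed
  moreover have "res_map b A (Suc i) w' l = g l" if "b i \<le> l" for l
    using that w(2) by (simp add: res_map_def)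
  ultimately have "res_map b A (Suc i) w' = g" by (intro ext) (meson not_le)
  with w' that show ?thesis by blast
qed

text \<open>Vanishing of the Koszul homology of the cokernels \<open>F\<^sub>i / syz i\<close>, by dimension shifting.\<close>

lemma koszul_syz:
  assumes "r + i \<le> e" "\<And>T. T \<subseteq> {1..2*n} \<Longrightarrow> hvec i (Suc e) (C T)"
    "\<And>T. T \<subseteq> {1..2*n} \<Longrightarrow> vbd C T \<in> syz i"
  shows "\<exists>B. (\<forall>T\<subseteq>{1..2*n}. hvec i e (B T)) \<and> (\<forall>T\<subseteq>{1..2*n}. (\<lambda>k. C T k - vbd B T k) \<in> syz i)"
  using assms
proof (induction i arbitrary: e C)
  case 0
  have "chain n (Suc e) (\<lambda>T. C T 0)"
    using hvecD(1,4)[OF 0(2), of _ 0] by (simp add: chain_def b_0 d_0)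
  moreover have "bd n (\<lambda>T. C T 0) T \<in> I" if "T \<subseteq> {1..2*n}" for T
    using 0(3)[OF that] by (simp add: syz_0 vbd_def)
  ultimately obtain B where B: "chain n e B" "\<And>T. T \<subseteq> {1..2*n} \<Longrightarrow> C T 0 - bd n B T \<in> I"
    using reg_leD[OF reg] 0(1) by (metis add_0_right)
  define B' where "B' = (\<lambda>T (k :: nat). if k = 0 then B T else (0 :: 'k mpoly))"
  have h: "hvec 0 e (B' T)" if "T \<subseteq> {1..2*n}" for T
    using B(1) that by (auto simp: hvec_def B'_def b_0 d_0 free_mod_def chain_def)
  moreover have "(\<lambda>k. C T k - vbd B' T k) \<in> syz 0" if T: "T \<subseteq> {1..2*n}" for T
  proof -
    have "hvec 0 (Suc e) (\<lambda>k. C T k - vbd B' T k)"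
      by (rule hvec_diff[OF 0(2)[OF T] hvec_vbd[OF h T]])
    then have "(\<lambda>k. C T k - vbd B' T k) \<in> free_mod n 1" by (simp add: hvec_def b_0)
    moreover have "C T 0 - vbd B' T 0 \<in> I" using B(2)[OF T] by (simp add: vbd_def B'_def)
    ultimately show ?thesis by (simp add: syz_0)
  qed
  ultimately show ?case by blast
next
  case (Suc i)
  obtain e' where e': "e = Suc e'" "r + i \<le> e'" using Suc.prems(1) by (cases e) auto
  define D where "D = (\<lambda>T. res_map b A (Suc i) (C T))"
  have D: "hvec i (Suc e) (D T)" if "T \<subseteq> {1..2*n}" for T
    unfolding D_def by (rule hvec_res_map(1)[OF Suc.prems(2)[OF that]])
  have vbdD: "vbd D T = (\<lambda>_. 0)" if T: "T \<subseteq> {1..2*n}" for T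
    using Suc.prems(3)[OF T] unfolding D_def by (simp add: syz_Suc flip: res_map_vbd)
  \<comment> \<open>The components of \<open>D\<close> are cycles over \<open>S\<close> itself, so
    they bound by exactness of the Koszul complex. The bounding chain \<open>B\<close> lives in
    \<open>F_i\<close> and has degree one less, as the induction hypothesis requires.\<close>
  have "\<exists>\<beta>. l < b i \<and> d i l \<le> e \<longrightarrow> chain n (e - d i l) \<beta> \<and> (\<forall>T\<subseteq>{1..2*n}. D T l = bd n \<beta> T)" for l
  proof (cases "l < b i \<and> d i l \<le> e")
    case True
    then have "chain n (Suc (e - d i l)) (\<lambda>T. D T l)"
      using hvecD(1,4)[OF D, of _ l] by (simp add: chain_def Suc_diff_le)
    moreover have "bd n (\<lambda>T. D T l) T = 0" if "T \<subseteq> {1..2*n}" for T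
      using vbdD[OF that] by (simp add: vbd_def fun_eq_iff)
    ultimately show ?thesis by (metis koszul_exact)
  qed auto
  then obtain \<beta> where \<beta>: "\<And>l. l < b i \<Longrightarrow> d i l \<le> e \<Longrightarrow> chain n (e - d i l) (\<beta> l)"
    "\<And>l T. l < b i \<Longrightarrow> d i l \<le> e \<Longrightarrow> T \<subseteq> {1..2*n} \<Longrightarrow> D T l = bd n (\<beta> l) T" by metis
  define B where "B = (\<lambda>T l. if l < b i \<and> d i l \<le> e then \<beta> l T else 0)"
  have B: "hvec i e (B T)" if "T \<subseteq> {1..2*n}" for T
    using \<beta>(1) that by (auto simp: hvec_def B_def free_mod_def chain_def)
  have DB: "D T = vbd B T" if T: "T \<subseteq> {1..2*n}" for T
  proof
    fix l
    consider "l < b i" "d i l \<le> e" | "l < b i" "d i l = Suc e" | "l < b i" "d i l > Suc e" | "b i \<le> l"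
      by linarith
    then show "D T l = vbd B T l"
    proof cases
      case 1
      then show ?thesis using \<beta>(2)[OF 1 T] by (simp add: vbd_def B_def)
    next
      \<comment> \<open>Here \<open>D T l\<close> would be a constant, a degree in which the Koszul
        complex is not exact; minimality of the resolution makes it zero.\<close>
      case 2
      then have "D T l = 0" unfolding D_def using hvec_res_map(2)[OF Suc.prems(2)[OF T]] by blast
      then show ?thesis using 2 by (simp add: vbd_def B_def)
    next
      case 3
      then show ?thesis using hvecD(2)[OF D[OF T]] by (simp add: vbd_def B_def)
    next
      case 4
      then show ?thesis using hvecD(3)[OF D[OF T]] by (simp add: vbd_def B_def)
    qed
  qed
  have vB: "vbd B T \<in> syz i" if T: "T \<subseteq> {1..2*n}" for T
    unfolding DB[OF T, symmetric] D_def syz_def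
    by (rule imageI) (use Suc.prems(2)[OF T] in \<open>simp add: hvec_def\<close>)
  have "\<exists>G. (\<forall>T\<subseteq>{1..2*n}. hvec i e' (G T)) \<and> (\<forall>T\<subseteq>{1..2*n}. (\<lambda>k. B T k - vbd G T k) \<in> syz i)"
    using e'(2) B[unfolded e'(1)] vB by (rule Suc.IH)
  then obtain G where G': "\<forall>T\<subseteq>{1..2*n}. hvec i e' (G T)"
    "\<forall>T\<subseteq>{1..2*n}. (\<lambda>k. B T k - vbd G T k) \<in> syz i" by blast
  note G = G'[rule_format]
  have "\<exists>w. T \<subseteq> {1..2*n} \<longrightarrow> hvec (Suc i) e w \<and> res_map b A (Suc i) w = (\<lambda>k. B T k - vbd G T k)" for T
  proof (cases "T \<subseteq> {1..2*n}")
    case True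
    have "hvec i e (\<lambda>k. B T k - vbd G T k)"
      by (rule hvec_diff[OF B[OF True] hvec_vbd[OF G(1) True, folded e'(1)]])
    from homogeneous_lift[OF this G(2)[OF True]] show ?thesis by blast
  qed auto
  then obtain W where W: "\<And>T. T \<subseteq> {1..2*n} \<Longrightarrow> hvec (Suc i) e (W T)"
    "\<And>T. T \<subseteq> {1..2*n} \<Longrightarrow> res_map b A (Suc i) (W T) = (\<lambda>k. B T k - vbd G T k)" by metis
  \<comment> \<open>The map of the resolution sends \<open>C - vbd W\<close> to
    \<open>D - vbd B\<close>, because \<open>vbd\<close> of \<open>vbd G\<close> vanishes; this is
    zero by the choice of \<open>B\<close>.\<close>
  have "(\<lambda>k. C T k - vbd W T k) \<in> syz (Suc i)" if T: "T \<subseteq> {1..2*n}" for T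
  proof -
    have "hvec (Suc i) (Suc e) (\<lambda>k. C T k - vbd W T k)"
      by (rule hvec_diff[OF Suc.prems(2)[OF T] hvec_vbd[OF W(1) T]])
    moreover have "res_map b A (Suc i) (\<lambda>k. C T k - vbd W T k) = (\<lambda>_. 0)"
    proof
      fix k
      have "vbd (\<lambda>U. res_map b A (Suc i) (W U)) T k = bd n (\<lambda>U. B U k - vbd G U k) T"
        unfolding vbd_def[of "\<lambda>U. res_map b A (Suc i) (W U)"]
        by (rule bd_cong[OF _ T]) (simp add: W(2))
      also have "\<dots> = vbd B T k"
        by (simp add: bd_diff vbd_def bd_bd[OF T])
      finally show "res_map b A (Suc i) (\<lambda>k. C T k - vbd W T k) k = 0"
        using DB[OF T] by (simp add: res_map_diff res_map_vbd D_def)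
    qed
    ultimately show ?thesis by (simp add: syz_Suc hvec_def)
  qed
  with W(1) show ?case by blast
qed

text \<open>The basis vector \<open>e_k\<close> of \<open>F_i\<close>, placed on the empty set, is a
  Koszul cycle. If its degree exceeded \<open>r + i\<close>, it would be a boundary modulo syzygies;
  but boundaries and, by minimality, syzygies have no constant terms, while \<open>e_k\<close> has
  the constant term 1.\<close>

lemma shift_le:
  assumes k: "k < b i"
  shows "d i k \<le> r + i"
proof (rule ccontr)
  assume "\<not> ?thesis"
  then obtain e where e: "d i k = Suc e" "r + i \<le> e" by (cases "d i k") auto
  define C where "C = (\<lambda>(T :: nat set) j. if T = {} \<and> j = k then 1 else (0 :: 'k mpoly))"
  have "hvec i (Suc e) (C T)" for T
    using k e homogeneous_neg1_power[of 0] by (auto simp: hvec_def C_def free_mod_def)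
  moreover have "vbd C T \<in> syz i" for T
  proof -
    have "vbd C T = (\<lambda>_. 0)" by (auto simp: vbd_def C_def bd_def fun_eq_iff)
    also have "\<dots> = res_map b A (Suc i) (\<lambda>_. 0)" by (simp add: res_map_def fun_eq_iff)
    also have "\<dots> \<in> syz i" unfolding syz_def by (rule imageI) (simp add: free_mod_def)
    finally show ?thesis .
  qed
  ultimately obtain B where B: "\<forall>T\<subseteq>{1..2*n}. (\<lambda>k. C T k - vbd B T k) \<in> syz i"
    using koszul_syz[OF e(2), of C] by blast
  then obtain w where "(\<lambda>k. C {} k - vbd B {} k) = res_map b A (Suc i) w"
    unfolding syz_def by blast
  then have eq: "1 = bd n (\<lambda>U. B U k) {} + (\<Sum>j<b (Suc i). A (Suc i) k j * w j)"
    using k by (auto simp: C_def vbd_def res_map_def fun_eq_iff algebra_simps dest: spec[of _ k])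
  have "Poly_Mapping.lookup (bd n (\<lambda>U. B U k) {}) 0 = 0"
    unfolding bd_def lookup_sum
    by (intro sum.neutral ballI) (simp add: mult.commute[of "sg _ _"] mult.assoc const_coeff_homogeneous_pos[OF homogeneous_var])
  moreover have "Poly_Mapping.lookup (A (Suc i) k j * w j) 0 = 0" if "j < b (Suc i)" for j
  proof (cases "A (Suc i) k j = 0")
    case False
    show ?thesis
      by (rule const_coeff_homogeneous_pos[OF entry(3)[OF k that False]]) (use entry(2)[OF k that False] in simp)
  qed simp
  then have "Poly_Mapping.lookup (\<Sum>j<b (Suc i). A (Suc i) k j * w j) 0 = 0"
    unfolding lookup_sum by (intro sum.neutral) auto
  ultimately have "Poly_Mapping.lookup (1 :: 'k mpoly) 0 = 0" unfolding eq lookup_add by simp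
  then show False by simp
qed

end

section \<open>Polynomials pushed forward along a map of exponents\<close>

definition push :: "('a \<Rightarrow> 'b) \<Rightarrow> ('a \<Rightarrow>\<^sub>0 'c::comm_monoid_add) \<Rightarrow> 'b \<Rightarrow>\<^sub>0 'c" where
  "push w f = (\<Sum>m\<in>Poly_Mapping.keys f. Poly_Mapping.single (w m) (Poly_Mapping.lookup f m))"

lemma push_superset:
  assumes "finite A" "Poly_Mapping.keys f \<subseteq> A"
  shows "push w f = (\<Sum>m\<in>A. Poly_Mapping.single (w m) (Poly_Mapping.lookup f m))"
  unfolding push_def using assms
  by (intro sum.mono_neutral_left) (auto simp: in_keys_iff)

lemma push_0 [simp]: "push w 0 = 0"
  by (simp add: push_def)

lemma push_single: "push w (Poly_Mapping.single m a) = Poly_Mapping.single (w m) a"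
  using push_superset[of "{m}" "Poly_Mapping.single m a" w] by simp

lemma push_add: "push w (f + g) = push w f + push w g"
proof -
  let ?A = "Poly_Mapping.keys f \<union> Poly_Mapping.keys g"
  have "push w (f + g) = (\<Sum>m\<in>?A. Poly_Mapping.single (w m) (Poly_Mapping.lookup (f + g) m))"
    by (rule push_superset) (use keys_add[of f g] in auto)
  then show ?thesis
    using push_superset[of ?A f w] push_superset[of ?A g w]
    by (simp add: lookup_add single_add sum.distrib)
qed

lemma push_push: "push w (push w' f) = push (w \<circ> w') f"
  by (induction f rule: pm_induct) (simp_all add: push_add push_single)

lemma push_mult:
  fixes f g :: "'a::monoid_add \<Rightarrow>\<^sub>0 'c::comm_semiring_1"
  assumes "\<And>m m'. w (m + m') = w m + w m'"
  shows "push w (f * g) = push w f * push w g"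
proof (induction f rule: pm_induct)
  case (single m a)
  show ?case
    by (induction g rule: pm_induct)
      (simp_all add: push_add push_single mult_single assms algebra_simps)
qed (simp_all add: push_add algebra_simps)

lemma push_uminus: "push w (- f) = - push w (f :: 'a \<Rightarrow>\<^sub>0 'c::ab_group_add)"
  using push_add[of w f "- f"] by (simp add: eq_neg_iff_add_eq_0 add.commute)

lemma push_diff: "push w (f - g) = push w f - push w (g :: 'a \<Rightarrow>\<^sub>0 'c::ab_group_add)"
  using push_add[of w f "- g"] by (simp add: push_uminus)

section \<open>Binomial edge ideals\<close>

text \<open>\<open>p\<close> and \<open>q\<close> exchange the roles of \<open>x\<close> and \<open>y\<close> on one side of a bipartition, which turns
  \<open>x a * x b - y a * y b\<close> into a generator of a binomial edge ideal. The dummy parameter only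
  fixes the coefficient field.\<close>

locale vertex_vars =
  fixes K :: "'k::field itself" and n :: nat and V :: "nat set" and p q :: "nat \<Rightarrow> nat"
  assumes finite_V: "finite V" and vars: "p ` V \<union> q ` V = {1..2*n}"
    and inj_p: "inj_on p V" and inj_q: "inj_on q V" and disj: "p ` V \<inter> q ` V = {}"
begin

definition edge :: "nat \<Rightarrow> nat \<Rightarrow> 'k mpoly" where
  "edge a b = var (p a) * var (q b) - var (q a) * var (p b)"

text \<open>Deleting a vertex is expressed by putting its two variables into \<open>B\<close>. All
  ideals then lie in the one ring \<open>S\<close>, and one Koszul complex serves for all
  graphs.\<close>

definition J :: "nat set \<Rightarrow> nat rel \<Rightarrow> 'k mpoly set" where
  "J B E = idl n (var ` B \<union> {edge a b | a b. (a, b) \<in> E})"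

lemma var_p_in [intro]: "a \<in> V \<Longrightarrow> var (p a) \<in> polyS n"
  and var_q_in [intro]: "a \<in> V \<Longrightarrow> var (q a) \<in> polyS n"
  using vars by blast+

lemma edge_in [intro]: "a \<in> V \<Longrightarrow> b \<in> V \<Longrightarrow> edge a b \<in> polyS n"
  unfolding edge_def by blast

lemma homogeneous_edge: "homogeneous 2 (edge a b)"
  unfolding edge_def numeral_2_eq_2
  using homogeneous_mult[OF homogeneous_var homogeneous_var] by (intro homogeneous_diff) fastforce+

lemma graded_ideal_J:
  assumes "B \<subseteq> {1..2*n}" "E \<subseteq> V \<times> V" shows "graded_ideal n (J B E)"
  unfolding J_def using assms homogeneous_var homogeneous_edge polyS_var
  by (intro graded_ideal_idl) blast+

lemma J_var: "k \<in> B \<Longrightarrow> var k \<in> J B E"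
  and J_edge: "(a, b) \<in> E \<Longrightarrow> edge a b \<in> J B E"
  unfolding J_def by (auto intro!: idl_gen)

lemma J_subset:
  assumes "\<And>k. k \<in> B \<Longrightarrow> var k \<in> J B' E'" "\<And>a b. (a, b) \<in> E \<Longrightarrow> edge a b \<in> J B' E'"
  shows "J B E \<subseteq> J B' E'"
  unfolding J_def[of B E] using assms unfolding J_def[of B' E'] by (intro idl_mono) blast

lemma J_mono: "B \<subseteq> B' \<Longrightarrow> E \<subseteq> E' \<Longrightarrow> J B E \<subseteq> J B' E'"
  by (intro J_subset) (auto intro: J_var J_edge)

lemma J_mult: "s \<in> polyS n \<Longrightarrow> g \<in> J B E \<Longrightarrow> s * g \<in> J B E"
  unfolding J_def by (rule idl_mult)

lemma J_add: "f \<in> J B E \<Longrightarrow> g \<in> J B E \<Longrightarrow> f + g \<in> J B E"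
  unfolding J_def by (rule idl_add)

lemma J_diff: "f \<in> J B E \<Longrightarrow> g \<in> J B E \<Longrightarrow> f - g \<in> J B E"
  using J_add[of f B E "- 1 * g"] J_mult[OF polyS_uminus[OF polyS_1]] by simp

lemma J_0: "0 \<in> J B E"
  unfolding J_def by (rule idl.zero)

lemma J_map:
  assumes "B' \<subseteq> {1..2*n}" "E' \<subseteq> V \<times> V" and h: "h 0 = 0" "\<And>f g. h (f + g) = h f + h g"
    "\<And>s k. s \<in> polyS n \<Longrightarrow> k \<in> B \<Longrightarrow> h (s * var k) \<in> J B' E'"
    "\<And>s a b. s \<in> polyS n \<Longrightarrow> (a, b) \<in> E \<Longrightarrow> h (s * edge a b) \<in> J B' E'"
    and g: "g \<in> J B E"
  shows "h g \<in> J B' E'"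
  by (rule idl_map[OF graded_ideal_J[OF assms(1,2)] h(1,2) _ g[unfolded J_def]]) (use h in blast)

lemma kill_J:
  assumes "B' \<subseteq> {1..2*n}" "E' \<subseteq> V \<times> V"
    "\<And>k. k \<in> B \<Longrightarrow> k \<notin> C \<Longrightarrow> var k \<in> J B' E'"
    "\<And>a b. (a, b) \<in> E \<Longrightarrow> kill C (edge a b) \<in> J B' E'"
    and g: "g \<in> J B E"
  shows "kill C g \<in> J B' E'"
  by (rule J_map[OF assms(1,2) kill_0 kill_add _ _ g])
    (auto simp: kill_mult kill_var J_0 intro!: J_mult assms)

lemma kill_edge: "kill C (edge a b) =
    (if p a \<in> C \<or> q b \<in> C then 0 else var (p a) * var (q b)) -
    (if q a \<in> C \<or> p b \<in> C then 0 else var (q a) * var (p b))"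
  by (simp add: edge_def kill_diff kill_mult kill_var)

lemma p_eq_iff: "a \<in> V \<Longrightarrow> b \<in> V \<Longrightarrow> p a = p b \<longleftrightarrow> a = b"
  and q_eq_iff: "a \<in> V \<Longrightarrow> b \<in> V \<Longrightarrow> q a = q b \<longleftrightarrow> a = b"
  and p_neq_q: "a \<in> V \<Longrightarrow> b \<in> V \<Longrightarrow> p a \<noteq> q b"
  using inj_p inj_q disj by (auto dest: inj_onD)

text \<open>The weight records the total degree at each vertex and the \<open>p\<close>-degree of each clique; it is
  the exponent of the image under the toric map \<open>p a \<mapsto> s a * t (cl a)\<close>, \<open>q a \<mapsto> s a\<close>.\<close>

definition wt :: "(nat \<Rightarrow> nat) \<Rightarrow> (nat \<Rightarrow>\<^sub>0 nat) \<Rightarrow> nat \<Rightarrow>\<^sub>0 nat" where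
  "wt cl m = (\<Sum>a\<in>V. Poly_Mapping.single (2 * a) (Poly_Mapping.lookup m (p a) + Poly_Mapping.lookup m (q a))
     + Poly_Mapping.single (2 * cl a + 1) (Poly_Mapping.lookup m (p a)))"

lemma wt_add: "wt cl (m + m') = wt cl m + wt cl m'"
  by (simp add: wt_def lookup_add single_add sum.distrib algebra_simps)

lemma lookup_wt_even:
  assumes "a \<in> V"
  shows "Poly_Mapping.lookup (wt cl m) (2 * a) = Poly_Mapping.lookup m (p a) + Poly_Mapping.lookup m (q a)"
proof -
  have odd: "Suc (2 * c) \<noteq> 2 * a" for c by presburger
  have "Poly_Mapping.lookup (wt cl m) (2 * a) =
      (\<Sum>b\<in>V. if a = b then Poly_Mapping.lookup m (p a) + Poly_Mapping.lookup m (q a) else 0)"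
    unfolding wt_def lookup_sum
    by (rule sum.cong) (auto simp: lookup_add lookup_single when_def odd)
  then show ?thesis using assms finite_V by simp
qed

lemma lookup_wt_odd:
  "Poly_Mapping.lookup (wt cl m) (2 * c + 1) = (\<Sum>a\<in>{a\<in>V. cl a = c}. Poly_Mapping.lookup m (p a))"
proof -
  have odd: "2 * a \<noteq> Suc (2 * c)" for a by presburger
  have "Poly_Mapping.lookup (wt cl m) (2 * c + 1) =
      (\<Sum>b\<in>V. if cl b = c then Poly_Mapping.lookup m (p b) else 0)"
    unfolding wt_def lookup_sum
    by (rule sum.cong) (auto simp: lookup_add lookup_single when_def odd)
  then show ?thesis using finite_V by (simp add: sum.inter_filter)
qed

lemma wt_single_p:
  assumes "a \<in> V"
  shows "wt cl (Poly_Mapping.single (p a) 1) = Poly_Mapping.single (2 * a) 1 + Poly_Mapping.single (2 * cl a + 1) 1"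
proof -
  have "wt cl (Poly_Mapping.single (p a) 1) =
    (\<Sum>b\<in>V. if a = b then Poly_Mapping.single (2 * a) 1 + Poly_Mapping.single (2 * cl a + 1) 1 else 0)"
    unfolding wt_def using assms p_neq_q[of a] p_neq_q
    by (intro sum.cong) (auto simp: lookup_single when_def p_eq_iff)
  then show ?thesis using assms finite_V by simp
qed

lemma wt_single_q:
  assumes "a \<in> V"
  shows "wt cl (Poly_Mapping.single (q a) 1) = Poly_Mapping.single (2 * a) 1"
proof -
  have "wt cl (Poly_Mapping.single (q a) 1) =
    (\<Sum>b\<in>V. if a = b then Poly_Mapping.single (2 * a) 1 else 0)"
    unfolding wt_def using assms p_neq_q
    by (intro sum.cong) (auto simp: lookup_single when_def q_eq_iff, metis+)
  then show ?thesis using assms finite_V by simp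
qed

text \<open>Monomials of equal weight are connected by the moves \<open>p a * q b \<leadsto> q a * p b\<close>.\<close>

lemma monomial_congruence:
  assumes E: "\<And>a b. a \<in> V \<Longrightarrow> b \<in> V \<Longrightarrow> a \<noteq> b \<Longrightarrow> cl a = cl b \<Longrightarrow> (a, b) \<in> E" "E \<subseteq> V \<times> V"
    and m: "Poly_Mapping.keys m \<subseteq> {1..2*n}" "Poly_Mapping.keys m' \<subseteq> {1..2*n}" "wt cl m = wt cl m'"
  shows "Poly_Mapping.single m c - Poly_Mapping.single m' c \<in> J {} E"
  using m
\<comment> \<open>The measure is the total excess of the \<open>p\<close>-exponents of
  \<open>m\<close> over those of \<open>m'\<close>, with truncated subtraction; each move lowers
  it.\<close>
proof (induction "\<Sum>a\<in>V. Poly_Mapping.lookup m (p a) - Poly_Mapping.lookup m' (p a)" arbitrary: m rule: less_induct)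
  case less
  let ?l = Poly_Mapping.lookup
  have ev: "?l m (p a) + ?l m (q a) = ?l m' (p a) + ?l m' (q a)" if "a \<in> V" for a
    using lookup_wt_even[OF that, of cl m] lookup_wt_even[OF that, of cl m'] less(4) by simp
  have od: "(\<Sum>a\<in>{a\<in>V. cl a = c}. ?l m (p a)) = (\<Sum>a\<in>{a\<in>V. cl a = c}. ?l m' (p a))" for c
    using lookup_wt_odd[of cl m c] lookup_wt_odd[of cl m' c] less(4) by simp
  show ?case
  proof (cases "\<forall>a\<in>V. ?l m (p a) = ?l m' (p a)")
    case True
    have "m = m'"
    proof (rule poly_mapping_eqI)
      fix k
      show "?l m k = ?l m' k"
      proof (cases "k \<in> {1..2*n}")
        case True
        then have "k \<in> p ` V \<union> q ` V" using vars by simp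
        then show ?thesis using \<open>\<forall>a\<in>V. ?l m (p a) = ?l m' (p a)\<close> ev by fastforce
      next
        case False
        then have "k \<notin> Poly_Mapping.keys m" "k \<notin> Poly_Mapping.keys m'" using less(2,3) by blast+
        then show ?thesis by (simp add: in_keys_iff)
      qed
    qed
    then show ?thesis by (simp add: J_0)
  next
    case False
    have "\<exists>a\<in>V. ?l m (p a) > ?l m' (p a)"
    proof (rule ccontr)
      assume "\<not> ?thesis"
      then have le: "\<forall>a\<in>V. ?l m (p a) \<le> ?l m' (p a)" by (auto simp: not_less)
      with False obtain a where a: "a \<in> V" "?l m (p a) < ?l m' (p a)" by (meson le_neq_implies_less)
      have "(\<Sum>b\<in>{b\<in>V. cl b = cl a}. ?l m (p b)) < (\<Sum>b\<in>{b\<in>V. cl b = cl a}. ?l m' (p b))"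
        using a le finite_V by (intro sum_strict_mono_ex1) auto
      then show False using od by simp
    qed
    then obtain a where a: "a \<in> V" "?l m (p a) > ?l m' (p a)" by blast
    \<comment> \<open>Both monomials have the same \<open>p\<close>-degree on the class of
      \<open>a\<close>, so the excess at \<open>a\<close> forces a deficit at some \<open>b\<close>
      of that class. As the total degrees at \<open>b\<close> agree, \<open>q b\<close> then divides
      \<open>m\<close>, and the move is possible.\<close>
    have "\<exists>b\<in>{b\<in>V. cl b = cl a}. ?l m (p b) < ?l m' (p b)"
    proof (rule ccontr)
      assume "\<not> ?thesis"
      then have le: "\<forall>b\<in>{b\<in>V. cl b = cl a}. ?l m' (p b) \<le> ?l m (p b)" by (auto simp: not_less)
      have "(\<Sum>b\<in>{b\<in>V. cl b = cl a}. ?l m' (p b)) < (\<Sum>b\<in>{b\<in>V. cl b = cl a}. ?l m (p b))"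
        using a le finite_V by (intro sum_strict_mono_ex1) auto
      then show False using od by simp
    qed
    then obtain b where b: "b \<in> V" "cl b = cl a" "?l m (p b) < ?l m' (p b)" by blast
    have ab: "a \<noteq> b" using a b by auto
    have qb: "?l m (q b) > 0" using ev[OF b(1)] b(3) by linarith
    have ne: "p a \<noteq> q b" "p a \<noteq> p b" "q a \<noteq> q b" "p b \<noteq> q a" "p a \<noteq> q a" "p b \<noteq> q b"
      using a b ab p_neq_q by (auto simp: p_eq_iff q_eq_iff)
    define s where "s = (\<lambda>k :: nat. Poly_Mapping.single k (1::nat))"
    define m0 where "m0 = m - s (p a) - s (q b)"
    have mm0: "m = m0 + s (p a) + s (q b)"
      using a qb ne unfolding m0_def s_def
      by (intro poly_mapping_eqI) (auto simp: lookup_add lookup_minus lookup_single when_def)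
    define m1 where "m1 = m0 + s (q a) + s (p b)"
    have wt1: "wt cl m1 = wt cl m"
      unfolding m1_def mm0 wt_add s_def wt_single_p[OF a(1)] wt_single_p[OF b(1)]
        wt_single_q[OF a(1)] wt_single_q[OF b(1)] b(2) by (simp add: algebra_simps)
    have key0: "Poly_Mapping.keys m0 \<subseteq> {1..2*n}" using less(2) unfolding mm0 keys_mon_add by blast
    have key1: "Poly_Mapping.keys m1 \<subseteq> {1..2*n}"
    proof -
      have "q a \<in> {1..2*n}" "p b \<in> {1..2*n}" using a b vars by blast+
      then show ?thesis using key0 unfolding m1_def keys_mon_add s_def by simp
    qed
    have l1: "?l m1 (p x) = (if x = a then ?l m (p x) - 1 else if x = b then ?l m (p x) + 1 else ?l m (p x))"
      if "x \<in> V" for x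
      using that a b ne p_neq_q[OF that b(1)] p_neq_q[OF that a(1)] p_eq_iff[OF that a(1)] p_eq_iff[OF that b(1)]
      unfolding m1_def mm0 s_def by (auto simp: lookup_add lookup_single when_def)
    have "(\<Sum>x\<in>V. ?l m1 (p x) - ?l m' (p x)) < (\<Sum>x\<in>V. ?l m (p x) - ?l m' (p x))"
    proof (rule sum_strict_mono_ex1[OF finite_V])
      show "\<forall>x\<in>V. ?l m1 (p x) - ?l m' (p x) \<le> ?l m (p x) - ?l m' (p x)"
        using l1 b(3) by auto
      show "\<exists>x\<in>V. ?l m1 (p x) - ?l m' (p x) < ?l m (p x) - ?l m' (p x)"
        using l1[OF a(1)] a by (intro bexI[of _ a]) auto
    qed
    from less(1)[OF this key1 less(3)] wt1 less(4)
    have 1: "Poly_Mapping.single m1 c - Poly_Mapping.single m' c \<in> J {} E" by simp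
    have "Poly_Mapping.single m c - Poly_Mapping.single m1 c = Poly_Mapping.single m0 c * edge a b"
      unfolding mm0 m1_def edge_def var_def s_def by (simp add: mult_single algebra_simps)
    moreover have "Poly_Mapping.single m0 c * edge a b \<in> J {} E"
      using E(1)[OF a(1) b(1) ab] b(2) key0 by (intro J_mult J_edge polyS_single) auto
    ultimately have "Poly_Mapping.single m c - Poly_Mapping.single m1 c \<in> J {} E" by simp
    from J_add[OF this 1] show ?thesis by simp
  qed
qed

text \<open>Choose one monomial of \<open>g\<close> for each weight that occurs. Replacing every
  monomial by the chosen one changes \<open>g\<close> by moves only, and the result is a further
  push-forward of \<open>push (wt cl) g\<close>, hence zero.\<close>

lemma toric_kernel:
  assumes E: "\<And>a b. a \<in> V \<Longrightarrow> b \<in> V \<Longrightarrow> a \<noteq> b \<Longrightarrow> cl a = cl b \<Longrightarrow> (a, b) \<in> E" "E \<subseteq> V \<times> V"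
    and g: "g \<in> polyS n" "push (wt cl) g = 0"
  shows "g \<in> J {} E"
proof -
  define \<rho> where "\<rho> = inv_into (Poly_Mapping.keys g) (wt cl)"
  have \<rho>: "\<rho> (wt cl m) \<in> Poly_Mapping.keys g" "wt cl (\<rho> (wt cl m)) = wt cl m" if "m \<in> Poly_Mapping.keys g" for m
    using that by (auto simp: \<rho>_def inv_into_into f_inv_into_f)
  have "push (\<rho> \<circ> wt cl) g = 0" using g(2) by (simp flip: push_push)
  then have "g = (\<Sum>m\<in>Poly_Mapping.keys g. Poly_Mapping.single m (Poly_Mapping.lookup g m) -
      Poly_Mapping.single (\<rho> (wt cl m)) (Poly_Mapping.lookup g m))"
    using pm_expand[of g] by (simp add: sum_subtractf push_def)
  moreover have "\<dots> \<in> J {} E"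
  proof (rule graded_ideal_sum[OF graded_ideal_J[OF _ E(2)]])
    fix m assume m: "m \<in> Poly_Mapping.keys g"
    show "Poly_Mapping.single m (Poly_Mapping.lookup g m) -
      Poly_Mapping.single (\<rho> (wt cl m)) (Poly_Mapping.lookup g m) \<in> J {} E"
      by (rule monomial_congruence[of cl, OF E]) (use \<rho>[OF m] m g(1) in \<open>auto simp: polyS_def\<close>)
  qed simp
  ultimately show ?thesis by simp
qed

lemma push_wt_J:
  assumes E: "\<And>a b. (a, b) \<in> E \<Longrightarrow> cl a = cl b" "E \<subseteq> V \<times> V" and g: "g \<in> J {} E"
  shows "push (wt cl) g = 0"
proof -
  have "push (wt cl) (edge a b :: 'k mpoly) = 0" if "(a, b) \<in> E" for a b
  proof -
    have "a \<in> V" "b \<in> V" "cl a = cl b" using that E by auto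
    then have "wt cl (Poly_Mapping.single (p a) 1 + Poly_Mapping.single (q b) 1) =
        wt cl (Poly_Mapping.single (q a) 1 + Poly_Mapping.single (p b) 1)"
      unfolding wt_add by (simp add: wt_single_p[simplified] wt_single_q[simplified] algebra_simps)
    then show ?thesis
      by (simp add: edge_def var_def mult_single push_diff push_single)
  qed
  from g[unfolded J_def] this show ?thesis
    by induction (auto simp: push_add push_mult wt_add)
qed

text \<open>Once the variables in \<open>B\<close> are set to zero, the ideal is the kernel of
  \<open>push (wt cl)\<close>, a ring map into a domain; a factor with nonzero image can therefore
  be cancelled.\<close>

lemma cliques_prime:
  assumes E: "\<And>a b. a \<in> V \<Longrightarrow> b \<in> V \<Longrightarrow> a \<noteq> b \<Longrightarrow> (a, b) \<in> E \<longleftrightarrow> cl a = cl b"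
      "E \<subseteq> V \<times> V" "irrefl E"
    and B: "B \<subseteq> {1..2*n}" "\<And>a b. (a, b) \<in> E \<Longrightarrow> kill B (edge a b :: 'k mpoly) = edge a b"
    and f: "kill B f = f" "push (wt cl) f \<noteq> 0"
    and g: "g \<in> polyS n" "f * g \<in> J B E"
  shows "g \<in> (J B E :: 'k mpoly set)"
proof -
  have cl: "cl a = cl b" if "(a, b) \<in> E" for a b
    using that E(1)[of a b] E(2,3) by (auto simp: irrefl_def)
  have "kill B (f * g) \<in> J {} E"
    by (rule kill_J[OF _ E(2) _ _ g(2)]) (simp_all add: B J_edge)
  then have "f * kill B g \<in> J {} E" by (simp add: kill_mult f)
  from push_wt_J[OF cl E(2) this] have "push (wt cl) (f * kill B g) = 0" .
  then have "push (wt cl) (kill B g) = 0" using f(2) by (simp add: push_mult wt_add)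
  then have "kill B g \<in> J {} E" using E(1) g(1) by (intro toric_kernel[OF _ E(2)]) auto
  then have 1: "kill B g \<in> J B E" using J_mono[of "{}" B E E] by blast
  have "idl n (var ` B) \<subseteq> (J B E :: 'k mpoly set)"
    unfolding J_def by (rule idl_mono) (auto intro: idl_gen)
  then have "g - kill B g \<in> J B E" using kill_diff_mem[OF g(1), of B] by blast
  from J_add[OF this 1] show ?thesis by simp
qed

end

section \<open>Graphs\<close>

definition graph :: "nat set \<Rightarrow> nat rel \<Rightarrow> bool" where
  "graph W E \<longleftrightarrow> finite W \<and> E \<subseteq> W \<times> W \<and> sym E \<and> irrefl E"

definition cone :: "nat rel \<Rightarrow> nat \<Rightarrow> nat rel" where
  "cone E v = E \<union> {(a, b). (v, a) \<in> E \<and> (v, b) \<in> E \<and> a \<noteq> b}"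

definition simplicial :: "nat rel \<Rightarrow> nat \<Rightarrow> bool" where
  "simplicial E v \<longleftrightarrow> (\<forall>a b. (v, a) \<in> E \<longrightarrow> (v, b) \<in> E \<longrightarrow> a \<noteq> b \<longrightarrow> (a, b) \<in> E)"

definition del :: "nat rel \<Rightarrow> nat \<Rightarrow> nat rel" where
  "del E v = {(a, b) \<in> E. a \<noteq> v \<and> b \<noteq> v}"

lemma graphD:
  assumes "graph W E"
  shows "finite W" "(a, b) \<in> E \<Longrightarrow> a \<in> W" "(a, b) \<in> E \<Longrightarrow> b \<in> W" "(a, b) \<in> E \<Longrightarrow> (b, a) \<in> E"
    "(a, b) \<in> E \<Longrightarrow> a \<noteq> b"
  using assms by (auto simp: graph_def sym_def irrefl_def)

lemma graph_cone: "graph W E \<Longrightarrow> graph W (cone E v)"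
  unfolding graph_def cone_def sym_def irrefl_def by blast

lemma graph_del: "graph W E \<Longrightarrow> graph (W - {v}) (del E v)"
  unfolding graph_def del_def sym_def irrefl_def by blast

lemma simplicial_cone_self:
  assumes "graph W E" shows "simplicial (cone E v) v"
  using graphD[OF assms] by (auto simp: simplicial_def cone_def)

text \<open>A vertex \<open>u\<close> other than \<open>v\<close> gains neighbours only if it is
  adjacent to \<open>v\<close>. Its old neighbours are then \<open>v\<close> itself or adjacent to
  \<open>v\<close>, so all its neighbours lie in the closed neighbourhood of \<open>v\<close>, which
  has become a clique.\<close>

lemma simplicial_cone:
  assumes "graph W E" "simplicial E u" shows "simplicial (cone E v) u"
  unfolding simplicial_def
proof (intro allI impI)
  fix a b assume ab: "(u, a) \<in> cone E v" "(u, b) \<in> cone E v" "a \<noteq> b"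
  have *: "(v, a) \<in> E" if "(u, a) \<in> E" "(v, u) \<in> E" "a \<noteq> v" for a
    using assms(2) graphD[OF assms(1)] that unfolding simplicial_def by blast
  from ab show "(a, b) \<in> cone E v"
    using * assms(2) graphD[OF assms(1)] unfolding cone_def simplicial_def by blast
qed

lemma simplicial_del: "simplicial E u \<Longrightarrow> simplicial (del E v) u"
  by (auto simp: simplicial_def del_def)

lemma not_simplicialE:
  assumes "\<not> simplicial E v"
  obtains a b where "(v, a) \<in> E" "(v, b) \<in> E" "a \<noteq> b" "(a, b) \<notin> E"
  using assms by (auto simp: simplicial_def)

text \<open>The induction measure counts vertices plus ordered pairs that are not edges; completing
  a neighbourhood that is not a clique removes such pairs.\<close>

lemma cone_measure:
  assumes "graph W E" "\<not> simplicial E v"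
  shows "card W + card (W \<times> W - cone E v) < card W + card (W \<times> W - E)"
proof -
  obtain a b where "(v, a) \<in> E" "(v, b) \<in> E" "a \<noteq> b" "(a, b) \<notin> E"
    using assms(2) by (rule not_simplicialE)
  then have "W \<times> W - cone E v \<subset> W \<times> W - E"
    using graphD[OF assms(1)] unfolding cone_def by blast
  then show ?thesis using graphD(1)[OF assms(1)] by (simp add: psubset_card_mono)
qed

text \<open>\<open>E'\<close> will be \<open>E\<close> or \<open>cone E v\<close>, which covers both
  deletions in the decomposition.\<close>

lemma del_measure:
  assumes "graph W E" "v \<in> W" "E \<subseteq> E'"
  shows "card (W - {v}) + card ((W - {v}) \<times> (W - {v}) - del E' v) < card W + card (W \<times> W - E)"
proof -
  have "card (W - {v}) < card W" using graphD(1)[OF assms(1)] assms(2) by (rule card_Diff1_less)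
  moreover have "card ((W - {v}) \<times> (W - {v}) - del E' v) \<le> card (W \<times> W - E)"
    using graphD(1)[OF assms(1)] assms(3) by (intro card_mono) (auto simp: del_def)
  ultimately show ?thesis by linarith
qed

text \<open>If all vertices are simplicial, adjacency is transitive on distinct vertices. A clique
  is labelled by its least vertex; a number outside \<open>W\<close> labels itself.\<close>

lemma clique_classes:
  assumes "graph W E" "\<And>v. v \<in> W \<Longrightarrow> simplicial E v"
  obtains cl :: "nat \<Rightarrow> nat" where "\<And>a b. a \<noteq> b \<Longrightarrow> (a, b) \<in> E \<longleftrightarrow> cl a = cl b"
proof -
  note G = graphD[OF assms(1)]
  have tr: "(a, c) \<in> E" if "(a, b) \<in> E" "(b, c) \<in> E" "a \<noteq> c" for a b c
    using assms(2)[OF G(3)[OF that(1)], unfolded simplicial_def] G(4)[OF that(1)] that(2,3) by blast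
  define C where "C = (\<lambda>a. insert a (E `` {a}))"
  define cl where "cl = (\<lambda>a. LEAST z. z \<in> C a)"
  have "(a, b) \<in> E \<longleftrightarrow> cl a = cl b" if "a \<noteq> b" for a b
  proof
    assume "(a, b) \<in> E"
    then have "(b, a) \<in> E" by (rule G(4))
    have "c \<in> C a \<longleftrightarrow> c \<in> C b" for c
      using tr[OF \<open>(a, b) \<in> E\<close>, of c] tr[OF \<open>(b, a) \<in> E\<close>, of c] \<open>(a, b) \<in> E\<close> \<open>(b, a) \<in> E\<close>
      unfolding C_def by blast
    then have "C a = C b" by blast
    then show "cl a = cl b" by (simp add: cl_def)
  next
    assume eq: "cl a = cl b"
    have "cl x \<in> C x" for x unfolding cl_def by (rule LeastI[of _ x]) (simp add: C_def)
    then have "cl a \<in> C a" "cl a \<in> C b" using eq by metis+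
    then have "cl a = a \<or> (a, cl a) \<in> E" "cl a = b \<or> (cl a, b) \<in> E"
      using G(4) unfolding C_def by auto
    then show "(a, b) \<in> E" using tr[of a "cl a" b] that by metis
  qed
  then show thesis by (rule that)
qed

section \<open>Paths as vertex lists\<close>

fun pedges :: "nat list \<Rightarrow> nat rel" where
  "pedges (x # y # zs) = {(x, y), (y, x)} \<union> pedges (y # zs)"
| "pedges _ = {}"

definition is_path :: "nat set \<Rightarrow> nat rel \<Rightarrow> bool" where
  "is_path W E \<longleftrightarrow> (\<exists>vs. distinct vs \<and> set vs = W \<and> E = pedges vs)"

lemma pedges_subset: "pedges vs \<subseteq> set vs \<times> set vs"
  by (induction vs rule: pedges.induct) auto

lemma pedges_bipartite: "distinct vs \<Longrightarrow> \<exists>c :: nat \<Rightarrow> bool. \<forall>(a, b)\<in>pedges vs. c a \<noteq> c b"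
proof (induction vs rule: pedges.induct)
  case (1 x y zs)
  then obtain c :: "nat \<Rightarrow> bool" where c: "\<forall>(a, b)\<in>pedges (y # zs). c a \<noteq> c b" by auto
  have "\<forall>(a, b)\<in>pedges (x # y # zs). (c(x := \<not> c y)) a \<noteq> (c(x := \<not> c y)) b"
  proof
    fix e assume e: "e \<in> pedges (x # y # zs)"
    have x: "x \<notin> set (y # zs)" using 1(2) by simp
    show "case e of (a, b) \<Rightarrow> (c(x := \<not> c y)) a \<noteq> (c(x := \<not> c y)) b"
    proof (cases "e \<in> pedges (y # zs)")
      case True
      then have "fst e \<noteq> x" "snd e \<noteq> x" using pedges_subset[of "y # zs"] x by auto
      then show ?thesis using c True by auto
    qed (use e x in auto)
  qed
  then show ?case by blast
qed auto

lemma is_path_triangle_free: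
  assumes "is_path W E" "(a, b) \<in> E" "(b, c) \<in> E" "(a, c) \<in> E" shows False
proof -
  obtain f :: "nat \<Rightarrow> bool" where "\<forall>(a, b)\<in>E. f a \<noteq> f b"
    using assms(1) pedges_bipartite unfolding is_path_def by blast
  then have "f a \<noteq> f b" "f b \<noteq> f c" "f a \<noteq> f c" using assms(2-4) by auto
  then show False by blast
qed

lemma pedges_append: "pedges (xs @ a # b # ys) = pedges (xs @ [a]) \<union> {(a, b), (b, a)} \<union> pedges (b # ys)"
proof (induction xs)
  case (Cons x xs)
  then show ?case by (cases xs) auto
qed simp

lemma pedges_split:
  "(a, b) \<in> pedges vs \<Longrightarrow> \<exists>xs ys. vs = xs @ a # b # ys \<or> vs = xs @ b # a # ys"
proof (induction vs rule: pedges.induct)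
  case (1 x y zs)
  show ?case
  proof (cases "(a, b) \<in> pedges (y # zs)")
    case True
    then obtain xs ys where "y # zs = xs @ a # b # ys \<or> y # zs = xs @ b # a # ys" using 1 by blast
    then have "x # y # zs = (x # xs) @ a # b # ys \<or> x # y # zs = (x # xs) @ b # a # ys" by simp
    then show ?thesis by blast
  next
    case False
    then have "(a = x \<and> b = y) \<or> (a = y \<and> b = x)" using 1(2) by auto
    then show ?thesis by (metis append_Nil)
  qed
qed auto

text \<open>Used in contrapositive form, to keep the deleted graph from being a path. A path has no
  triangle, so \<open>v\<close> has exactly two neighbours \<open>a\<close> and \<open>b\<close>;
  the edge added between them lies on the path, and putting \<open>v\<close> back subdivides
  it.\<close>

lemma is_path_uncone:
  assumes G: "graph W E" and v: "v \<in> W" "\<not> simplicial E v"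
    and P: "is_path (W - {v}) (del (cone E v) v)"
  shows "is_path W E"
proof -
  note GE = graphD[OF G]
  let ?P = "del (cone E v) v"
  obtain vs where vs: "distinct vs" "set vs = W - {v}" "?P = pedges vs"
    using P by (auto simp: is_path_def)
  obtain a' b' where ab': "(v, a') \<in> E" "(v, b') \<in> E" "a' \<noteq> b'" "(a', b') \<notin> E"
    using v(2) by (rule not_simplicialE)
  then have "(a', b') \<in> pedges vs" unfolding vs(3)[symmetric] using GE by (auto simp: del_def cone_def)
  then obtain xs ys where "vs = xs @ a' # b' # ys \<or> vs = xs @ b' # a' # ys" using pedges_split by blast
  then obtain a b where ab: "(v, a) \<in> E" "(v, b) \<in> E" "a \<noteq> b" "(a, b) \<notin> E" "vs = xs @ a # b # ys"
    using ab' GE(4) by metis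
  have nb: "c = a \<or> c = b" if "(v, c) \<in> E" for c
  proof (rule ccontr)
    assume "\<not> ?thesis"
    then have "(a, b) \<in> ?P" "(b, c) \<in> ?P" "(a, c) \<in> ?P"
      using that ab(1-3) GE(5) by (auto simp: del_def cone_def)
    then show False using is_path_triangle_free[OF P] by blast
  qed
  have ba: "(b, a) \<notin> E" using ab(4) GE(4) by blast
  have dist: "a \<notin> set ys" "b \<notin> set xs" using vs(1) ab(5) by auto
  have "pedges (xs @ [a]) \<union> pedges (b # ys) = ?P - {(a, b), (b, a)}"
    unfolding vs(3) ab(5) pedges_append
    using pedges_subset[of "xs @ [a]"] pedges_subset[of "b # ys"] dist ab(3) by auto
  also have "\<dots> = {(x, y) \<in> E. x \<noteq> v \<and> y \<noteq> v}"
  proof -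
    have "(x, y) \<in> ?P - {(a, b), (b, a)} \<longleftrightarrow> (x, y) \<in> E \<and> x \<noteq> v \<and> y \<noteq> v" for x y
      using nb[of x] nb[of y] ab(4) ba unfolding del_def cone_def by auto
    then show ?thesis by auto
  qed
  finally have eq: "pedges (xs @ [a]) \<union> pedges (b # ys) = {(x, y) \<in> E. x \<noteq> v \<and> y \<noteq> v}" .
  have "pedges (xs @ a # v # b # ys) = (pedges (xs @ [a]) \<union> pedges (b # ys)) \<union> {(a, v), (v, a), (v, b), (b, v)}"
    unfolding pedges_append by auto
  also have "\<dots> = E"
  proof -
    have "{(a, v), (v, a), (v, b), (b, v)} = {(x, y) \<in> E. x = v \<or> y = v}"
      using nb ab(1,2) GE(4) by blast
    moreover have "E = {(x, y) \<in> E. x \<noteq> v \<and> y \<noteq> v} \<union> {(x, y) \<in> E. x = v \<or> y = v}" by auto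
    ultimately show ?thesis unfolding eq by simp
  qed
  finally have "E = pedges (xs @ a # v # b # ys)" ..
  moreover have "distinct (xs @ a # v # b # ys)" "set (xs @ a # v # b # ys) = W"
    using vs(1,2) v(1) unfolding ab(5) by auto
  ultimately show ?thesis unfolding is_path_def by blast
qed

lemma cone_not_path:
  assumes "graph W E" "\<not> simplicial E v" shows "\<not> is_path W (cone E v)"
proof
  assume P: "is_path W (cone E v)"
  obtain a b where "(v, a) \<in> E" "(v, b) \<in> E" "a \<noteq> b" using assms(2) by (rule not_simplicialE)
  then have "(v, a) \<in> cone E v" "(a, b) \<in> cone E v" "(v, b) \<in> cone E v" by (auto simp: cone_def)
  with is_path_triangle_free[OF P] show False by blast
qed

lemma pedges_nth:
  "(a, b) \<in> pedges vs \<longleftrightarrow>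
    (\<exists>i. Suc i < length vs \<and> (a = vs ! i \<and> b = vs ! Suc i \<or> b = vs ! i \<and> a = vs ! Suc i))"
proof (induction vs rule: pedges.induct)
  case (1 x y zs)
  have "(\<exists>i. Suc i < length (x # y # zs) \<and> Q i) \<longleftrightarrow> Q 0 \<or> (\<exists>i. Suc i < length (y # zs) \<and> Q (Suc i))" for Q
    by (metis (no_types, lifting) Suc_less_eq length_Cons not0_implies_Suc zero_less_Suc)
  from this[of "\<lambda>i. a = (x # y # zs) ! i \<and> b = (x # y # zs) ! Suc i \<or> b = (x # y # zs) ! i \<and> a = (x # y # zs) ! Suc i"]
  show ?case using 1 by auto
qed auto

lemma path_endpoint:
  assumes "distinct vs" "u \<in> set vs" "\<And>a b. (u, a) \<in> pedges vs \<Longrightarrow> (u, b) \<in> pedges vs \<Longrightarrow> a = b"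
  shows "u = vs ! 0 \<or> u = vs ! (length vs - 1)"
proof (rule ccontr)
  assume *: "\<not> ?thesis"
  obtain i where i: "i < length vs" "u = vs ! i" using assms(2) by (auto simp: in_set_conv_nth)
  then have "i \<noteq> 0" "i \<noteq> length vs - 1" using * by metis+
  then obtain j where j: "i = Suc j" "Suc i < length vs" using i(1) by (cases i) auto
  then have "(u, vs ! j) \<in> pedges vs" "(u, vs ! Suc i) \<in> pedges vs"
    unfolding pedges_nth using i by (metis Suc_lessD)+
  then have "vs ! j = vs ! Suc i" by (rule assms(3))
  then show False using assms(1) j by (simp add: nth_eq_iff_index_eq)
qed

section \<open>Regularity of binomial edge ideals\<close>

context vertex_vars
begin

definition off :: "nat set \<Rightarrow> nat set" where
  "off W = p ` (V - W) \<union> q ` (V - W)"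

definition graph_reg_le :: "nat set \<Rightarrow> nat rel \<Rightarrow> nat \<Rightarrow> bool" where
  "graph_reg_le W E r \<longleftrightarrow> reg_le n (J (off W) E) r"

lemma off_subset: "off W \<subseteq> {1..2*n}"
  using vars unfolding off_def by blast

lemma p_off_iff: "a \<in> V \<Longrightarrow> p a \<in> off W \<longleftrightarrow> a \<notin> W"
  and q_off_iff: "a \<in> V \<Longrightarrow> q a \<in> off W \<longleftrightarrow> a \<notin> W"
  using p_neq_q unfolding off_def by (auto simp: p_eq_iff q_eq_iff, metis+)

lemma graph_reg_le_mono: "graph_reg_le W E r \<Longrightarrow> r \<le> s \<Longrightarrow> graph_reg_le W E s"
  unfolding graph_reg_le_def by (rule reg_le_mono)

lemma kill_edge_disjoint:
  "p a \<notin> C \<Longrightarrow> q a \<notin> C \<Longrightarrow> p b \<notin> C \<Longrightarrow> q b \<notin> C \<Longrightarrow> kill C (edge a b) = edge a b"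
  by (simp add: kill_edge) (simp add: edge_def)

lemma image_vars_iff:
  assumes "a \<in> V" "U \<subseteq> V"
  shows "p a \<in> p ` U \<longleftrightarrow> a \<in> U" "q a \<in> q ` U \<longleftrightarrow> a \<in> U" "p a \<notin> q ` U" "q a \<notin> p ` U"
proof -
  show "p a \<in> p ` U \<longleftrightarrow> a \<in> U" "q a \<in> q ` U \<longleftrightarrow> a \<in> U"
    using inj_on_image_mem_iff[OF inj_p assms] inj_on_image_mem_iff[OF inj_q assms] .
  show "p a \<notin> q ` U" "q a \<notin> p ` U"
    using assms disj by auto
qed

lemma idl_vars_J: "idl n (var ` B) \<subseteq> J B E"
  unfolding J_def by (rule idl_mono) (auto intro: idl_gen)

lemma J_insert: "g \<in> J (insert k B) E \<Longrightarrow> \<exists>g1\<in>J B E. \<exists>a\<in>polyS n. g = g1 + var k * a"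
  unfolding J_def image_insert Un_insert_left by (rule idl_insert)

section \<open>Ohtani's decomposition and the resulting regularity bound\<close>

lemma cone_edges:
  assumes "(a, b) \<in> cone E v" "graph W E"
  obtains "(a, b) \<in> E" | "(v, a) \<in> E" "(v, b) \<in> E" "a \<noteq> b" "a \<noteq> v" "b \<noteq> v"
  using assms graphD(5)[OF assms(2)] by (auto simp: cone_def)

text \<open>The Pluecker relation: an added edge multiplied by a variable at \<open>v\<close> is a
  combination of the two old edges from \<open>v\<close> to its ends.\<close>

lemma var_mult_cone:
  assumes G: "graph W E" and W: "W \<subseteq> V" and B: "B \<subseteq> {1..2*n}" and g: "g \<in> J B (cone E v)"
  shows "v \<in> W \<Longrightarrow> var (p v) * g \<in> J B E" and "v \<in> W \<Longrightarrow> var (q v) * g \<in> J B E"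
proof -
  have E: "E \<subseteq> V \<times> V" using G W by (auto simp: graph_def)
  have "var (p v) * edge a b \<in> J B E \<and> var (q v) * edge a b \<in> J B E"
    if ab: "(a, b) \<in> cone E v" and v: "v \<in> W" for a b
    using ab G
  proof (cases rule: cone_edges)
    case 1
    then show ?thesis using v W by (auto intro!: J_mult J_edge)
  next
    case 2
    have abV: "a \<in> V" "b \<in> V" using 2 E by auto
    have eq: "var (p v) * edge a b = var (p a) * edge v b + (- var (p b)) * edge v a"
      "var (q v) * edge a b = var (q a) * edge v b + (- var (q b)) * edge v a"
      by (simp_all add: edge_def algebra_simps)
    show ?thesis unfolding eq
      by (intro conjI J_add J_mult J_edge polyS_uminus var_p_in var_q_in abV 2)
  qed
  note edge_case = this
  have "var t * g \<in> J B E" if t: "t = p v \<or> t = q v" and v: "v \<in> W" for t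
  proof (rule J_map[OF B E _ _ _ _ g])
    have tS: "var t \<in> polyS n" using t v W by blast
    show "var t * (s * var k) \<in> J B E" if "s \<in> polyS n" "k \<in> B" for s k
      using that tS by (auto intro!: J_mult J_var)
    fix s :: "'k mpoly" and a b assume "s \<in> polyS n" "(a, b) \<in> cone E v"
    then have "s * (var t * edge a b) \<in> J B E" using edge_case[of a b] v t by (intro J_mult[of s]) auto
    then show "var t * (s * edge a b) \<in> J B E" by (simp add: algebra_simps)
  qed (auto simp: algebra_simps)
  then show "v \<in> W \<Longrightarrow> var (p v) * g \<in> J B E" "v \<in> W \<Longrightarrow> var (q v) * g \<in> J B E" by auto
qed

text \<open>Split \<open>g\<close> into its part without the variables at \<open>v\<close> and the
  rest. The first part lies in \<open>J B E\<close> because \<open>g\<close> is in the second ideal.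
  The rest does so because \<open>g\<close> is in the first: added edges then occur only with
  coefficients in \<open>(p_v, q_v)\<close>, where the Pluecker relation applies.\<close>

lemma J_cone_Int:
  assumes G: "graph W E" and W: "W \<subseteq> V" and B: "B \<subseteq> {1..2*n}" and v: "v \<in> W"
  shows "J B E = J B (cone E v) \<inter> J (B \<union> {p v, q v}) E"
proof
  show "J B E \<subseteq> J B (cone E v) \<inter> J (B \<union> {p v, q v}) E"
    by (intro Int_greatest J_mono) (auto simp: cone_def)
  have E: "E \<subseteq> V \<times> V" using G W by (auto simp: graph_def)
  let ?C = "{p v, q v}"
  have vV: "v \<in> V" using v W by blast
  have killE: "kill ?C (edge a b) = (if a = v \<or> b = v then 0 else edge a b)" if "a \<in> V" "b \<in> V" for a b
    using that vV p_neq_q[OF vV that(1)] p_neq_q[OF vV that(2)] p_neq_q[OF that(1) vV] p_neq_q[OF that(2) vV]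
    by (simp add: kill_edge p_eq_iff q_eq_iff) (auto simp: edge_def)
  show "J B (cone E v) \<inter> J (B \<union> ?C) E \<subseteq> J B E"
  proof (intro subsetI, elim IntE)
    fix g assume g: "g \<in> J B (cone E v)" "g \<in> J (B \<union> ?C) E"
    have "kill ?C (edge a b) \<in> J B E" if ab: "(a, b) \<in> E" for a b
      using killE[of a b] ab E J_edge[OF ab] J_0 by auto
    then have 1: "kill ?C g \<in> J B E"
      by (intro kill_J[OF B E _ _ g(2)]) (auto intro: J_var)
    have "g - kill ?C g \<in> J B E"
    proof (rule J_map[OF B E _ _ _ _ g(1), of "\<lambda>g. g - kill ?C g"])
      fix s :: "'k mpoly" and k assume "s \<in> polyS n" "k \<in> B"
      then have "s * var k - kill ?C s * kill ?C (var k) \<in> J B E"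
        by (intro J_diff J_mult J_var) (auto simp: kill_var intro: J_var J_0)
      then show "s * var k - kill ?C (s * var k) \<in> J B E" by (simp add: kill_mult)
    next
      fix s :: "'k mpoly" and a b assume s: "s \<in> polyS n" and ab: "(a, b) \<in> cone E v"
      show "s * edge a b - kill ?C (s * edge a b) \<in> J B E"
        using ab G
      proof (cases rule: cone_edges)
        case 1
        then have abV: "a \<in> V" "b \<in> V" using E by auto
        from 1 have "s * edge a b - kill ?C s * kill ?C (edge a b) \<in> J B E"
          using s killE[OF abV] by (intro J_diff J_mult J_edge) (auto intro: J_edge J_0)
        then show ?thesis by (simp add: kill_mult)
      next
        case 2
        then have abV: "a \<in> V" "b \<in> V" using E by auto
        have "s * edge a b - kill ?C (s * edge a b) = (s - kill ?C s) * edge a b"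
          using killE[OF abV] 2 by (simp add: kill_mult algebra_simps)
        moreover have "t * edge a b \<in> J B E" if "t \<in> idl n (var ` ?C)" for t
        proof (rule idl_map[OF graded_ideal_J[OF B E] _ _ _ that, of "\<lambda>t. t * edge a b"])
          fix s' g :: "'k mpoly" assume s': "s' \<in> polyS n" and "g \<in> (var ` ?C :: 'k mpoly set)"
          then have "g * edge a b \<in> J B E"
            using var_mult_cone[OF G W B J_edge[OF ab] v] by auto
          from J_mult[OF s' this] show "s' * g * edge a b \<in> J B E" by (simp add: mult.assoc)
        qed (auto simp: algebra_simps)
        ultimately show ?thesis using kill_diff_mem[OF s] by metis
      qed
    qed (auto simp: kill_add)
    from J_add[OF this 1] show "g \<in> J B E" by simp
  qed
qed

lemma off_Diff: "v \<in> V \<Longrightarrow> off (W - {v}) = off W \<union> {p v, q v}"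
  unfolding off_def by auto

text \<open>An edge with an end outside \<open>W\<close> is a combination of the two variables at
  that end, which are already in the ideal.\<close>

lemma J_off_restrict:
  assumes E: "E \<subseteq> V \<times> V"
  shows "J (off W) E = J (off W) {(a, b) \<in> E. a \<in> W \<and> b \<in> W}"
proof
  show "J (off W) E \<subseteq> J (off W) {(a, b) \<in> E. a \<in> W \<and> b \<in> W}"
  proof (rule J_subset[OF J_var])
    fix a b assume ab: "(a, b) \<in> E"
    then have abV: "a \<in> V" "b \<in> V" using E by auto
    show "edge a b \<in> J (off W) {(a, b) \<in> E. a \<in> W \<and> b \<in> W}"
    proof (cases "a \<in> W \<and> b \<in> W")
      case False
      have eq: "edge a b = var (q b) * var (p a) + (- var (p b)) * var (q a)"
        "edge a b = var (p a) * var (q b) + (- var (q a)) * var (p b)"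
        by (simp_all add: edge_def)
      have vin: "var (p x) \<in> J (off W) F" "var (q x) \<in> J (off W) F" if "x \<in> V" "x \<notin> W" for x F
        using that by (auto intro!: J_var simp: p_off_iff q_off_iff)
      from False consider "a \<notin> W" | "b \<notin> W" by blast
      then show ?thesis
      proof cases
        case 1
        show ?thesis unfolding eq(1) by (intro J_add J_mult vin polyS_uminus var_p_in var_q_in abV 1)
      next
        case 2
        show ?thesis unfolding eq(2) by (intro J_add J_mult vin polyS_uminus var_p_in var_q_in abV 2)
      qed
    qed (use ab in \<open>auto intro: J_edge\<close>)
  qed
next
  show "J (off W) {(a, b) \<in> E. a \<in> W \<and> b \<in> W} \<subseteq> J (off W) E" by (intro J_mono) auto
qed

lemma J_off_del:
  assumes "graph W E" "W \<subseteq> V" "v \<in> W"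
  shows "J (off W \<union> {p v, q v}) E = J (off (W - {v})) (del E v)"
proof -
  have E: "E \<subseteq> V \<times> V" using assms by (auto simp: graph_def)
  have "del E v = {(a, b) \<in> E. a \<in> W - {v} \<and> b \<in> W - {v}}"
    using graphD[OF assms(1)] by (auto simp: del_def)
  then show ?thesis using J_off_restrict[OF E, of "W - {v}"] off_Diff[of v W] assms by auto
qed

text \<open>The sum of the two ideals of the decomposition belongs to the completed graph with
  \<open>v\<close> deleted, so it is this graph that has to meet the smaller bound
  \<open>r\<close>.\<close>

lemma graph_reg_le_cone:
  assumes G: "graph W E" and W: "W \<subseteq> V" and v: "v \<in> W"
    and r: "graph_reg_le W (cone E v) (Suc r)" "graph_reg_le (W - {v}) (del E v) (Suc r)" "graph_reg_le (W - {v}) (del (cone E v) v) r"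
  shows "graph_reg_le W E (Suc r)"
proof -
  let ?B = "off W" and ?B' = "off W \<union> {p v, q v}"
  have EV: "E \<subseteq> V \<times> V" "cone E v \<subseteq> V \<times> V"
    using G graph_cone[OF G] W by (auto simp: graph_def)
  have B': "?B' \<subseteq> {1..2*n}" using off_subset v W vars by blast
  show ?thesis unfolding graph_reg_le_def
  proof (rule reg_le_mayer_vietoris[of n "J ?B (cone E v)" "J ?B' E" _ "J ?B' (cone E v)"])
    show "graded_ideal n (J ?B (cone E v))" by (rule graded_ideal_J[OF off_subset EV(2)])
    show "graded_ideal n (J ?B' E)" by (rule graded_ideal_J[OF B' EV(1)])
    show "graded_ideal n (J ?B' (cone E v))" by (rule graded_ideal_J[OF B' EV(2)])
    show "J ?B E = J ?B (cone E v) \<inter> J ?B' E" by (rule J_cone_Int[OF G W off_subset v])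
    show "J ?B (cone E v) \<subseteq> J ?B' (cone E v)" "J ?B' E \<subseteq> J ?B' (cone E v)"
      by (intro J_mono; auto simp: cone_def)+
    show "reg_le n (J ?B (cone E v)) (Suc r)" using r(1) by (simp add: graph_reg_le_def)
    show "reg_le n (J ?B' E) (Suc r)" using r(2) unfolding graph_reg_le_def J_off_del[OF G W v] .
    show "reg_le n (J ?B' (cone E v)) r" using r(3) unfolding graph_reg_le_def J_off_del[OF graph_cone[OF G] W v] .
    fix g assume "g \<in> J ?B' (cone E v)"
    then have "g \<in> idl n ((var ` ?B \<union> {edge a b |a b. (a, b) \<in> cone E v}) \<union>
        (var ` ?B' \<union> {edge a b |a b. (a, b) \<in> E}))"
      unfolding J_def by (rule rev_subsetD) (intro idl_mono subset_trans[OF _ idl_gens], blast)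
    then show "\<exists>p1\<in>J ?B (cone E v). \<exists>p2\<in>J ?B' E. g = p1 + p2"
      unfolding J_def by (rule idl_Un)
  qed
qed

text \<open>No generator involves the variables in \<open>D\<close>, so they are nonzerodivisors one
  after the other.\<close>

lemma reg_le_free_vars:
  assumes "finite D" "D \<subseteq> {1..2*n}" "B \<subseteq> {1..2*n}" "E \<subseteq> V \<times> V" "D \<inter> B = {}"
    "\<And>a b k. (a, b) \<in> E \<Longrightarrow> k \<in> D \<Longrightarrow> kill {k} (edge a b :: 'k mpoly) = edge a b"
    and r: "reg_le n (J (B \<union> D) E) r"
  shows "reg_le n (J B E) r"
  using assms
proof (induction D arbitrary: B rule: finite_induct)
  case (insert k D)
  have B': "insert k B \<subseteq> {1..2*n}" using insert.prems by blast
  have "reg_le n (J (insert k B) E) r"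
    by (rule insert.IH[OF _ B']) (use insert.prems insert.hyps in \<open>auto simp: Un_commute\<close>)
  then show ?case
  proof (rule reg_le_nonzerodivisor[rotated -1])
    show "graded_ideal n (J B E)" by (rule graded_ideal_J) (use insert.prems in auto)
    show "k \<in> {1..2*n}" using insert.prems by blast
    show "g \<in> J B E" if "var k * g \<in> J B E" for g
      using that unfolding J_def
      by (rule nonzerodivisor_free_var[rotated]) (use insert.prems in \<open>auto simp: kill_var\<close>)
    show "J B E \<subseteq> J (insert k B) E" by (intro J_mono) auto
  qed (rule J_insert)
qed simp

section \<open>Graphs without edges and disjoint unions of cliques\<close>

lemma graph_reg_le_no_edges: "graph_reg_le W {} 0"
  using reg_le_vars[OF off_subset] unfolding graph_reg_le_def J_def by simp

lemma push_var: "push w (var k) = Poly_Mapping.single (w (Poly_Mapping.single k 1)) 1"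
  by (simp add: var_def push_single)

lemma cliques_nonzerodivisor:
  assumes G: "graph W E" and W: "W \<subseteq> V" and simp: "\<And>v. v \<in> W \<Longrightarrow> simplicial E v"
    and f: "kill (off W) f = f" "\<And>cl. push (wt cl) f \<noteq> 0"
    and g: "g \<in> polyS n" "f * g \<in> J (off W) E"
  shows "g \<in> J (off W) E"
proof -
  obtain cl :: "nat \<Rightarrow> nat" where cl: "\<And>a b. a \<noteq> b \<Longrightarrow> (a, b) \<in> E \<longleftrightarrow> cl a = cl b"
    using clique_classes[OF G simp] by blast
  show ?thesis
  proof (rule cliques_prime[of E cl, OF cl _ _ off_subset _ f(1) f(2) g])
    show "E \<subseteq> V \<times> V" "irrefl E" using G W by (auto simp: graph_def)
    fix a b assume "(a, b) \<in> E"
    then have "a \<in> W" "b \<in> W" using graphD[OF G] by blast+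
    then show "kill (off W) (edge a b :: 'k mpoly) = edge a b"
      using W by (intro kill_edge_disjoint) (auto simp: p_off_iff q_off_iff subset_iff)
  qed
qed

text \<open>The bound is \<open>card W - 2\<close>, written so that a single edge on two vertices
  gets 1. The exact value is the number of cliques with an edge, but this cruder bound follows by
  removing one vertex: \<open>p v\<close> is a nonzerodivisor by primeness, and modulo
  \<open>p v\<close> the colon sequence of \<open>q v\<close> leads to smaller graphs.\<close>

lemma graph_reg_le_cliques:
  assumes "graph W E" "W \<subseteq> V" "\<And>v. v \<in> W \<Longrightarrow> simplicial E v"
  shows "graph_reg_le W E (if E = {} then 0 else Suc (card W - 3))"
  using assms
proof (induction "card W" arbitrary: W E rule: less_induct)
  case less
  note G = less.prems(1) and W = less.prems(2)
  show ?case
  proof (cases "E = {}")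
    case True
    then show ?thesis using graph_reg_le_no_edges by simp
  next
    case False
    then obtain v c where vc: "(v, c) \<in> E" by auto
    note GE = graphD[OF G]
    have v: "v \<in> W" "v \<in> V" using GE(2)[OF vc] W by auto
    have cv: "c \<in> W" "c \<noteq> v" using GE(3,5)[OF vc] by auto
    \<comment> \<open>A uniform weakening for smaller graphs with or without edges: an edge forces
      two vertices, so \<open>Suc (card W' - 3) \<le> card W' - 1\<close>.\<close>
    have IH: "graph_reg_le W' E' (card W' - 1)"
      if W': "card W' < card W" "graph W' E'" "W' \<subseteq> V" "\<And>v. v \<in> W' \<Longrightarrow> simplicial E' v" for W' E'
    proof (cases "E' = {}")
      case True
      then show ?thesis using graph_reg_le_mono[OF graph_reg_le_no_edges] by simp
    next
      case False
      then obtain a b where ab: "a \<in> W'" "b \<in> W'" "a \<noteq> b"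
        using graphD(2,3,5)[OF W'(2)] by (metis ex_in_conv surj_pair)
      have "card {a, b} \<le> card W'" using ab graphD(1)[OF W'(2)] by (intro card_mono) auto
      then have "Suc (card W' - 3) \<le> card W' - 1" using ab(3) by simp
      then show ?thesis using graph_reg_le_mono less.hyps[OF W'] False by auto
    qed
    define C where "C = insert v (E `` {v})"
    have C: "C \<subseteq> W" "v \<in> C" "c \<in> C" using GE(3) v vc by (auto simp: C_def)
    have closed: "a \<in> C \<longleftrightarrow> b \<in> C" if ab: "(a, b) \<in> E" for a b
    proof -
      have "b \<in> C" if "a \<in> C" "(a, b) \<in> E" for a b
        using less.prems(3)[OF GE(2)[OF that(2)], unfolded simplicial_def, rule_format, of v b]
          that GE(4) unfolding C_def by blast
      from this[of a b] this[of b a] show ?thesis using ab GE(4)[OF ab] by blast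
    qed
    define W' where "W' = W - C"
    define E' where "E' = {(a, b) \<in> E. a \<in> W' \<and> b \<in> W'}"
    have E': "E' \<subseteq> E" by (auto simp: E'_def)
    have EV: "E \<subseteq> V \<times> V" using G W by (auto simp: graph_def)
    have G': "graph W' E'" using G unfolding graph_def E'_def W'_def sym_def irrefl_def by auto
    have simp': "simplicial E' x" if "x \<in> W'" for x
      using less.prems(3)[of x] that unfolding simplicial_def E'_def W'_def by blast
    have card2: "card W' + 2 \<le> card W"
    proof -
      have "card {v, c} \<le> card C" using C GE(1) by (intro card_mono) (auto intro: finite_subset)
      moreover have "card W' = card W - card C" "card C \<le> card W"
        using C GE(1) by (auto simp: W'_def card_Diff_subset finite_subset card_mono)
      ultimately show ?thesis using cv by simp
    qed
    have kE: "kill D (edge a b :: 'k mpoly) = edge a b"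
      if "(a, b) \<in> E" "a \<notin> U" "b \<notin> U" "D \<subseteq> p ` U \<union> q ` U" "U \<subseteq> V" for D U a b
    proof -
      have "a \<in> V" "b \<in> V" using EV that by auto
      then have nin: "x \<notin> p ` U \<union> q ` U" if "x \<in> {p a, q a, p b, q b}" for x
        using that \<open>a \<notin> U\<close> \<open>b \<notin> U\<close> \<open>a \<in> V\<close> \<open>b \<in> V\<close>
        by (elim insertE) (simp_all add: image_vars_iff[OF _ \<open>U \<subseteq> V\<close>])
      show ?thesis by (intro kill_edge_disjoint contra_subsetD[OF that(4) nin]) simp_all
    qed
    have CV: "C \<subseteq> V" using C W by blast
    let ?B = "off W"
    let ?K = "J (?B \<union> p ` C) E'"
    let ?I1 = "J (insert (p v) ?B) E"
    have pvX: "p v \<in> {1..2*n}" and qvX: "q v \<in> {1..2*n}" using v vars by blast+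
    have E'V: "E' \<subseteq> V \<times> V" using EV E' by blast
    have offW': "off W' = ?B \<union> p ` C \<union> q ` C"
      using C CV unfolding off_def W'_def by blast
    have BC: "?B \<union> p ` C \<subseteq> {1..2*n}" using off_subset vars CV by blast
    have gI1: "graded_ideal n ?I1" by (rule graded_ideal_J[OF _ EV]) (use off_subset pvX in blast)
    \<comment> \<open>This is the ideal of the graph on \<open>W'\<close> with the variables
      \<open>q a\<close> left free for \<open>a\<close> in \<open>C\<close>. The clique
      \<open>C\<close> contains \<open>v\<close> and \<open>c\<close>, so
      \<open>card W' - 1 \<le> card W - 3\<close>.\<close>
    have rK: "reg_le n ?K (card W - 3)"
    proof (rule reg_le_free_vars)
      show "finite (q ` C)" using finite_subset[OF C(1) GE(1)] by simp
      show "q ` C \<subseteq> {1..2*n}" using vars CV by blast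
      show "?B \<union> p ` C \<subseteq> {1..2*n}" by (rule BC)
      show "E' \<subseteq> V \<times> V" by (rule E'V)
      show "q ` C \<inter> (?B \<union> p ` C) = {}"
        using C CV image_vars_iff(4)[OF _ CV] by (auto simp: q_off_iff subset_iff)
      show "kill {k} (edge a b :: 'k mpoly) = edge a b" if "(a, b) \<in> E'" "k \<in> q ` C" for a b k
        by (rule kE[of _ _ C]) (use that CV in \<open>auto simp: E'_def W'_def\<close>)
      have "graph_reg_le W' E' (card W' - 1)"
        by (rule IH) (use card2 G' simp' W in \<open>auto simp: W'_def\<close>)
      then have "graph_reg_le W' E' (card W - 3)" by (rule graph_reg_le_mono) (use card2 in simp)
      then show "reg_le n (J (?B \<union> p ` C \<union> q ` C) E') (card W - 3)"
        unfolding graph_reg_le_def offW' .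
    qed
    \<comment> \<open>Modulo \<open>p v\<close> an edge from \<open>v\<close> to \<open>a\<close>
      becomes \<open>q v * p a\<close> up to sign, so \<open>p a\<close> is in the colon ideal for
      each \<open>a\<close> in \<open>C\<close>. Conversely, setting these variables to zero kills
      all edges inside \<open>C\<close> and leaves an ideal free of \<open>q v\<close>.\<close>
    have K_iff: "var (q v) * g \<in> ?I1 \<longleftrightarrow> g \<in> ?K" if g: "g \<in> polyS n" for g
    proof
      assume "g \<in> ?K"
      show "var (q v) * g \<in> ?I1"
      proof (rule J_map[OF _ EV _ _ _ _ \<open>g \<in> ?K\<close>])
        show "insert (p v) ?B \<subseteq> {1..2*n}" using off_subset pvX by blast
        fix s :: "'k mpoly" and k assume s: "s \<in> polyS n" and "k \<in> ?B \<union> p ` C"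
        then consider "k \<in> insert (p v) ?B" | a where "(v, a) \<in> E" "k = p a" by (auto simp: C_def)
        then have "var (q v) * var k \<in> ?I1"
        proof cases
          case 1
          then show ?thesis using v by (auto intro!: J_mult J_var)
        next
          case 2
          then have "a \<in> V" using EV by blast
          have eq: "var (q v) * var k = var (q a) * var (p v) - edge v a"
            using 2 by (simp add: edge_def algebra_simps)
          show ?thesis unfolding eq using 2 \<open>a \<in> V\<close>
            by (intro J_diff J_mult J_var J_edge) auto
        qed
        from J_mult[OF s this] show "var (q v) * (s * var k) \<in> ?I1" by (simp add: algebra_simps)
      next
        fix s :: "'k mpoly" and a b assume "s \<in> polyS n" "(a, b) \<in> E'"
        then show "var (q v) * (s * edge a b) \<in> ?I1" using v E' by (auto intro!: J_mult J_edge)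
      qed (auto simp: algebra_simps)
    next
      assume h: "var (q v) * g \<in> ?I1"
      have "kill (p ` C) (var (q v) * g) \<in> J ?B E'"
      proof (rule kill_J[OF off_subset E'V _ _ h])
        show "var k \<in> J ?B E'" if "k \<in> insert (p v) ?B" "k \<notin> p ` C" for k
          using that C(2) by (auto intro: J_var)
        show "kill (p ` C) (edge a b) \<in> J ?B E'" if ab: "(a, b) \<in> E" for a b
        proof (cases "a \<in> C")
          case True
          then have "kill (p ` C) (edge a b) = 0" using closed[OF ab] by (simp add: kill_edge)
          then show ?thesis by (simp add: J_0)
        next
          case False
          then have "b \<notin> C" using closed[OF ab] by blast
          then have "(a, b) \<in> E'" using ab False GE(2,3)[OF ab] by (simp add: E'_def W'_def)
          moreover have "kill (p ` C) (edge a b :: 'k mpoly) = edge a b"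
            by (rule kE[OF ab False \<open>b \<notin> C\<close> _ CV]) blast
          ultimately show ?thesis by (simp add: J_edge)
        qed
      qed
      moreover have "q v \<notin> p ` C" using p_neq_q CV v by (metis imageE subsetD)
      ultimately have "var (q v) * kill (p ` C) g \<in> J ?B E'" by (simp add: kill_mult kill_var)
      then have "kill (p ` C) g \<in> J ?B E'"
        unfolding J_def
      proof (rule nonzerodivisor_free_var[rotated])
        fix x :: "'k mpoly" assume "x \<in> var ` ?B \<union> {edge a b |a b. (a, b) \<in> E'}"
        then consider k where "x = var k" "k \<in> ?B" | a b where "x = edge a b" "(a, b) \<in> E'" by blast
        then show "kill {q v} x = x"
        proof cases
          case 1
          then show ?thesis using v by (auto simp: kill_var q_off_iff)
        next
          case 2
          then show ?thesis using C(2) CV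
            by (simp, intro kE[of _ _ C]) (auto simp: E'_def W'_def)
        qed
      qed
      then have 1: "kill (p ` C) g \<in> ?K" using J_mono[of ?B "?B \<union> p ` C" E' E'] by blast
      have "g - kill (p ` C) g \<in> J (p ` C) E'" using kill_diff_mem[OF g] idl_vars_J by blast
      then have "g - kill (p ` C) g \<in> ?K" using J_mono[of "p ` C" "?B \<union> p ` C" E' E'] by blast
      from J_add[OF this 1] show "g \<in> ?K" by simp
    qed
    have rI1: "reg_le n ?I1 (Suc (card W - 3))"
    proof (rule reg_le_colon_var[OF gI1 qvX K_iff J_insert _ _ rK])
      show "?I1 \<subseteq> J (insert (q v) (insert (p v) ?B)) E" by (intro J_mono) auto
      show "?K \<subseteq> polyS n" using graded_ideal_J[OF BC E'V] by (simp add: graded_ideal_def)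
      have "insert (q v) (insert (p v) ?B) = ?B \<union> {p v, q v}" by auto
      then have eq: "J (insert (q v) (insert (p v) ?B)) E = J (off (W - {v})) (del E v)"
        using J_off_del[OF G W v(1)] by simp
      have "graph_reg_le (W - {v}) (del E v) (card (W - {v}) - 1)"
        using GE(1) v(1) W less.prems(3)
        by (intro IH graph_del[OF G] simplicial_del card_Diff1_less) auto
      then have "graph_reg_le (W - {v}) (del E v) (Suc (card W - 3))"
        by (rule graph_reg_le_mono) (use GE(1) v(1) in simp)
      then show "reg_le n (J (insert (q v) (insert (p v) ?B)) E) (Suc (card W - 3))"
        unfolding eq graph_reg_le_def .
    qed
    have "reg_le n (J ?B E) (Suc (card W - 3))"
    proof (rule reg_le_nonzerodivisor[OF graded_ideal_J[OF off_subset EV] pvX _ J_insert _ rI1])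
      show "g \<in> J ?B E" if "g \<in> polyS n" "var (p v) * g \<in> J ?B E" for g
      proof (rule cliques_nonzerodivisor[OF G W less.prems(3) _ _ that])
        show "kill ?B (var (p v)) = (var (p v) :: 'k mpoly)" using v by (simp add: kill_var p_off_iff)
        show "push (wt cl) (var (p v) :: 'k mpoly) \<noteq> 0" for cl by (simp add: push_var flip: keys_eq_empty)
      qed
      show "J ?B E \<subseteq> ?I1" by (intro J_mono) auto
    qed
    then show ?thesis using False by (simp add: graph_reg_le_def)
  qed
qed

text \<open>One induction gives both bounds, as the second needs the first. For a graph that is not
  a path, \<open>cone E v\<close> contains a triangle and meets the second bound;
  \<open>del E v\<close> has one vertex less, so the first bound suffices;
  \<open>del (cone E v) v\<close> must reach \<open>card W - 3\<close>, which holds because it is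
  not a path either.\<close>

lemma graph_reg_le_card:
  assumes "graph W E" "W \<subseteq> V"
  shows "graph_reg_le W E (card W - 1)" and "\<not> is_path W E \<Longrightarrow> graph_reg_le W E (card W - 2)"
proof -
  have "graph_reg_le W E (card W - 1) \<and> (\<not> is_path W E \<longrightarrow> graph_reg_le W E (card W - 2))"
    using assms
  proof (induction "card W + card (W \<times> W - E)" arbitrary: W E rule: less_induct)
    case less
    note G = less.prems(1) and W = less.prems(2)
    note GE = graphD[OF G]
    show ?case
    proof (cases "\<forall>v\<in>W. simplicial E v")
      case True
      then have r: "graph_reg_le W E (if E = {} then 0 else Suc (card W - 3))" using graph_reg_le_cliques[OF G W] by blast
      show ?thesis
      proof (cases "E = {}")
        case True
        then show ?thesis using graph_reg_le_mono[OF graph_reg_le_no_edges] by simp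
      next
        case False
        then obtain a b where ab: "(a, b) \<in> E" by auto
        note ab' = GE(2,3,5)[OF ab]
        have c2: "card {a, b} \<le> card W" using ab' GE(1) by (intro card_mono) auto
        have r': "graph_reg_le W E (Suc (card W - 3))" using r False by simp
        \<comment> \<open>An edge on just two vertices is a path, so a non-path with an edge has a
          third vertex.\<close>
        have "card W \<ge> 3" if np: "\<not> is_path W E"
        proof (rule ccontr)
          assume "\<not> card W \<ge> 3"
          then have "card W \<le> card {a, b}" using ab' by simp
          then have "{a, b} = W" using ab' GE(1) by (intro card_seteq) auto
          then have "(x, y) \<in> E \<longleftrightarrow> (x, y) \<in> {(a, b), (b, a)}" for x y
            using GE(2,3,5)[of x y] GE(4)[OF ab] ab by blast
          then have "E = pedges [a, b]" by auto
          then show False using np \<open>{a, b} = W\<close> ab' unfolding is_path_def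
            by (metis distinct_length_2_or_more distinct_singleton empty_set list.simps(15))
        qed
        then show ?thesis using graph_reg_le_mono[OF r'] c2 ab' by auto
      qed
    next
      case False
      then obtain v where v: "v \<in> W" "\<not> simplicial E v" by blast
      obtain a b where ab: "(v, a) \<in> E" "(v, b) \<in> E" "a \<noteq> b" "(a, b) \<notin> E"
        using v(2) by (rule not_simplicialE)
      have "card {v, a, b} \<le> card W" using ab GE(1,2,3) by (intro card_mono) auto
      moreover have "card {v, a, b} = 3" using ab GE(5) by auto
      ultimately have c3: "card W \<ge> 3" by simp
      have WV: "W - {v} \<subseteq> V" using W by blast
      have card: "card (W - {v}) = card W - 1" using v(1) GE(1) by simp
      have c1: "graph_reg_le W (cone E v) (card W - 2)"
        using less.hyps[OF cone_measure[OF G v(2)] graph_cone[OF G] W] cone_not_path[OF G v(2)] by blast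
      have c2: "graph_reg_le (W - {v}) (del E v) (card W - 2)"
        using less.hyps[OF del_measure[OF G v(1) order_refl] graph_del[OF G] WV] card by (simp add: numeral_2_eq_2)
      have EE: "E \<subseteq> cone E v" by (auto simp: cone_def)
      note IH3 = less.hyps[OF del_measure[OF G v(1) EE] graph_del[OF graph_cone[OF G]] WV]
      have c3': "graph_reg_le (W - {v}) (del (cone E v) v) (card W - 2)"
        using IH3 card by (simp add: numeral_2_eq_2)
      have "Suc (card W - 2) = card W - 1" using c3 by simp
      then have 1: "graph_reg_le W E (card W - 1)"
        using graph_reg_le_cone[OF G W v(1) graph_reg_le_mono[OF c1] graph_reg_le_mono[OF c2] c3'] by simp
      have "graph_reg_le W E (card W - 2)" if np: "\<not> is_path W E"
      proof -
        have "\<not> is_path (W - {v}) (del (cone E v) v)" using is_path_uncone[OF G v] np by blast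
        then have "graph_reg_le (W - {v}) (del (cone E v) v) (card W - 3)"
          using IH3 card by (simp add: numeral_3_eq_3 numeral_2_eq_2)
        moreover have "Suc (card W - 3) = card W - 2" using c3 by simp
        ultimately show ?thesis using graph_reg_le_cone[OF G W v(1)] c1 c2 by metis
      qed
      with 1 show ?thesis by blast
    qed
  qed
  then show "graph_reg_le W E (card W - 1)" "\<not> is_path W E \<Longrightarrow> graph_reg_le W E (card W - 2)" by blast+
qed

section \<open>The quadric of the removed edge and its colon ideal\<close>

definition quad :: "nat \<Rightarrow> nat \<Rightarrow> 'k mpoly" where
  "quad u w = var (p u) * var (p w) - var (q u) * var (q w)"

text \<open>The decomposition is applied at non-simplicial vertices only, so \<open>u\<close> and
  \<open>w\<close> survive down to the disjoint unions of cliques. There the two monomials of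
  \<open>quad u w\<close> have weights of different degree, so its image under the toric map is
  nonzero.\<close>

lemma quad_nonzerodivisor:
  assumes "graph W E" "W \<subseteq> V" "u \<in> W" "w \<in> W" "simplicial E u" "simplicial E w"
    "g \<in> polyS n" "quad u w * g \<in> J (off W) E"
  shows "g \<in> J (off W) E"
  using assms
proof (induction "card W + card (W \<times> W - E)" arbitrary: W E rule: less_induct)
  case less
  note G = less.prems(1) and W = less.prems(2)
  show ?case
  proof (cases "\<forall>v\<in>W. simplicial E v")
    case True
    have uw: "u \<in> V" "w \<in> V" using less.prems by auto
    show ?thesis
    proof (rule cliques_nonzerodivisor[OF G W _ _ _ less.prems(7,8)])
      show "kill (off W) (quad u w) = quad u w"
        using less.prems(3,4) uw by (simp add: quad_def kill_diff kill_mult kill_var p_off_iff q_off_iff)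
      fix cl
      let ?m = "wt cl (Poly_Mapping.single (p u) 1 + Poly_Mapping.single (p w) 1)"
      let ?m' = "wt cl (Poly_Mapping.single (q u) 1 + Poly_Mapping.single (q w) 1)"
      have "?m = ?m' + (Poly_Mapping.single (2 * cl u + 1) 1 + Poly_Mapping.single (2 * cl w + 1) 1)"
        unfolding wt_add wt_single_p[OF uw(1)] wt_single_p[OF uw(2)] wt_single_q[OF uw(1)] wt_single_q[OF uw(2)]
        by (simp add: algebra_simps)
      then have "mon_deg ?m = mon_deg ?m' + 2" by (simp add: mon_deg_add)
      then have "?m \<noteq> ?m'" by auto
      moreover have "push (wt cl) (quad u w) = Poly_Mapping.single ?m 1 - Poly_Mapping.single ?m' 1"
        by (simp add: quad_def var_def mult_single push_diff push_single)
      ultimately have "Poly_Mapping.lookup (push (wt cl) (quad u w)) ?m = 1"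
        by (simp add: lookup_minus lookup_single when_def)
      then show "push (wt cl) (quad u w) \<noteq> 0" by auto
    qed (use True in blast)
  next
    case False
    then obtain v where v: "v \<in> W" "\<not> simplicial E v" by blast
    have uwv: "u \<noteq> v" "w \<noteq> v" using v less.prems by auto
    have EE: "E \<subseteq> E" by simp
    have int: "J (off W) E = J (off W) (cone E v) \<inter> J (off (W - {v})) (del E v)"
      using J_cone_Int[OF G W off_subset v(1)] J_off_del[OF G W v(1)] by simp
    have "g \<in> J (off W) (cone E v)"
      by (rule less.hyps[OF cone_measure[OF G v(2)] graph_cone[OF G] W])
        (use less.prems int simplicial_cone[OF G] in auto)
    moreover have "g \<in> J (off (W - {v})) (del E v)"
      by (rule less.hyps[OF del_measure[OF G v(1) EE] graph_del[OF G]])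
        (use less.prems int uwv in \<open>auto intro: simplicial_del\<close>)
    ultimately show ?thesis using int by blast
  qed
qed

lemma off_V: "off V = {}"
  by (simp add: off_def)

lemma reg_le_quad:
  assumes G: "graph V E" and uw: "u \<in> V" "w \<in> V" "u \<noteq> w"
    and np: "\<not> is_path V (cone (cone E u) w)"
  shows "reg_le n (idl n (insert (quad u w) {edge a b | a b. (a, b) \<in> E})) (card V - 1)"
proof -
  let ?F = "cone (cone E u) w"
  have VV: "V \<subseteq> V" by simp
  have GF: "graph V (cone E u)" "graph V ?F" by (intro graph_cone G)+
  have EV: "E \<subseteq> V \<times> V" "?F \<subseteq> V \<times> V" using G GF by (auto simp: graph_def)
  have "card {u, w} \<le> card V" using uw finite_V by (intro card_mono) auto
  then have S: "Suc (card V - 2) = card V - 1" using uw by simp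
  have B: "{} \<subseteq> {1..2*n}" by simp
  have "reg_le n (idl n (insert (quad u w) {edge a b | a b. (a, b) \<in> E})) (Suc (card V - 2))"
  proof (rule reg_le_add_quadric[of n "J {} E" _ "J {} ?F"])
    show "graded_ideal n (J {} E)" by (rule graded_ideal_J[OF B EV(1)])
    show "quad u w \<in> polyS n" using uw unfolding quad_def by (intro polyS_diff polyS_mult) auto
    show "homogeneous 2 (quad u w)"
      unfolding quad_def numeral_2_eq_2
      using homogeneous_mult[OF homogeneous_var homogeneous_var] by (intro homogeneous_diff) fastforce+
    show "g \<in> idl n (insert (quad u w) {edge a b |a b. (a, b) \<in> E}) \<longleftrightarrow>
      (\<exists>p1\<in>J {} E. \<exists>a\<in>polyS n. g = p1 + quad u w * a)" for g
      unfolding J_def by (simp add: idl_insert_iff)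
    show "J {} ?F \<subseteq> polyS n" using graded_ideal_J[OF B EV(2)] by (simp add: graded_ideal_def)
    show "reg_le n (J {} ?F) (card V - 2)"
      using graph_reg_le_card(2)[OF GF(2) VV np] by (simp add: graph_reg_le_def off_V)
    show "reg_le n (J {} E) (Suc (card V - 2))"
      using graph_reg_le_card(1)[OF G VV] by (simp add: graph_reg_le_def off_V S)
    show "quad u w * g \<in> J {} E \<longleftrightarrow> g \<in> J {} ?F" if g: "g \<in> polyS n" for g
    proof
      assume "quad u w * g \<in> J {} E"
      moreover have "J {} E \<subseteq> J {} ?F" by (intro J_mono) (auto simp: cone_def)
      ultimately have "quad u w * g \<in> J (off V) ?F" by (auto simp: off_V)
      then have "g \<in> J (off V) ?F"
        by (rule quad_nonzerodivisor[OF GF(2) VV uw(1,2) simplicial_cone[OF GF(1) simplicial_cone_self[OF G]]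
            simplicial_cone_self[OF GF(1)] g])
      then show "g \<in> J {} ?F" by (simp add: off_V)
    next
      assume g: "g \<in> J {} ?F"
      \<comment> \<open>The two completions are undone in turn: a variable at \<open>w\<close> leads
        back to \<open>cone E u\<close>, a variable at \<open>u\<close> from there to
        \<open>E\<close>.\<close>
      note g1 = var_mult_cone[OF GF(1) VV B g uw(2)]
      have "var (p u) * (var (p w) * g) + (- 1) * (var (q u) * (var (q w) * g)) \<in> J {} E"
        using var_mult_cone(1)[OF G VV B g1(1) uw(1)] var_mult_cone(2)[OF G VV B g1(2) uw(1)]
        by (intro J_add J_mult[OF polyS_uminus[OF polyS_1]])
      then show "quad u w * g \<in> J {} E" by (simp add: quad_def algebra_simps)
    qed
  qed
  then show ?thesis unfolding S .
qed

end

section \<open>Parity binomial edge ideals\<close>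

text \<open>\<open>G\<close> may contain an edge in both orientations and with either sign, while
  \<open>idealIG\<close> has a single coefficient for each edge.\<close>

lemma idealIG_eq_idl:
  fixes G :: "'k::field mpoly set"
  assumes "finite E"
    and G: "\<And>g. g \<in> G \<Longrightarrow> \<exists>e\<in>E. g = (\<Prod>i\<in>e. xv n i) - (\<Prod>i\<in>e. yv n i) \<or> g = - ((\<Prod>i\<in>e. xv n i) - (\<Prod>i\<in>e. yv n i))"
    and E: "\<And>e. e \<in> E \<Longrightarrow> (\<Prod>i\<in>e. xv n i) - (\<Prod>i\<in>e. yv n i) \<in> idl n G"
  shows "idealIG n E = idl n G"
proof
  show "idealIG n E \<subseteq> idl n G"
  proof
    fix g :: "'k mpoly" assume "g \<in> idealIG n E"
    then obtain c where c: "\<forall>e. c e \<in> polyS n"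
      "g = (\<Sum>e\<in>E. c e * (\<Prod>i\<in>e. xv n i) - c e * (\<Prod>i\<in>e. yv n i))"
      by (auto simp: idealIG_def)
    have "c e * (\<Prod>i\<in>e. xv n i) - c e * (\<Prod>i\<in>e. yv n i) \<in> idl n G" if "e \<in> E" for e
      using idl_mult[OF c(1)[rule_format, of e] E[OF that]] by (simp add: right_diff_distrib)
    then show "g \<in> idl n G" unfolding c(2) by (rule idl_sum)
  qed
  show "idl n G \<subseteq> idealIG n E"
  proof
    fix g assume "g \<in> idl n G"
    then show "g \<in> idealIG n E"
    proof induction
      case zero
      then show ?case unfolding idealIG_def by (auto intro!: exI[of _ "\<lambda>_. 0"])
    next
      case (step s g q)
      let ?g = "\<lambda>e. (\<Prod>i\<in>e. xv n i) - (\<Prod>i\<in>e. yv n i) :: 'k mpoly"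
      obtain c where c: "\<forall>e. c e \<in> polyS n" "q = (\<Sum>e\<in>E. c e * ?g e)"
        using step by (auto simp: idealIG_def right_diff_distrib)
      obtain e where e: "e \<in> E" "g = ?g e \<or> g = - ?g e" using G step by blast
      then obtain t where t: "t \<in> polyS n" "s * g = t * ?g e"
        using step(1) by (metis minus_mult_commute polyS_uminus)
      have "s * g + q = (\<Sum>e'\<in>E. (if e' = e then t * ?g e else 0) + c e' * ?g e')"
        using e(1) assms(1) by (simp add: sum.distrib t(2) c(2))
      also have "\<dots> = (\<Sum>e'\<in>E. (c(e := c e + t)) e' * ?g e')"
        by (rule sum.cong) (auto simp: algebra_simps)
      finally have "s * g + q = (\<Sum>e'\<in>E. (c(e := c e + t)) e' * ?g e')" .
      moreover have "\<forall>e'. (c(e := c e + t)) e' \<in> polyS n" using c(1) t(1) by auto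
      ultimately show ?case unfolding idealIG_def right_diff_distrib by blast
    qed
  qed
qed

text \<open>If completing the neighbourhoods of \<open>u\<close> and \<open>w\<close> gives a path, then no edge was added
  and \<open>u\<close>, \<open>w\<close> are the endpoints of the path.\<close>

lemma path_cone_odd_cycle:
  fixes c :: "nat \<Rightarrow> bool"
  assumes G: "graph {1..n} H" and uw: "u \<noteq> w" "u \<in> {1..n}" "w \<in> {1..n}"
    and c: "\<And>a b. (a, b) \<in> H \<Longrightarrow> c a \<noteq> c b" "c u = c w"
    and P: "is_path {1..n} (cone (cone H u) w)"
    and E: "\<And>e. e \<in> E \<longleftrightarrow> e = {u, w} \<or> (\<exists>a b. e = {a, b} \<and> (a, b) \<in> H)"
  shows "is_odd_cycle n E"
proof -
  have degu: "a = b" if "(u, a) \<in> H" "(u, b) \<in> H" for a b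
  proof (rule ccontr)
    assume "a \<noteq> b"
    then have "(u, a) \<in> cone (cone H u) w" "(a, b) \<in> cone (cone H u) w" "(u, b) \<in> cone (cone H u) w"
      using that by (auto simp: cone_def)
    then show False using is_path_triangle_free[OF P] by blast
  qed
  have degw: "a = b" if "(w, a) \<in> H" "(w, b) \<in> H" for a b
  proof (rule ccontr)
    assume "a \<noteq> b"
    then have "(w, a) \<in> cone (cone H u) w" "(a, b) \<in> cone (cone H u) w" "(w, b) \<in> cone (cone H u) w"
      using that by (auto simp: cone_def)
    then show False using is_path_triangle_free[OF P] by blast
  qed
  have "cone H u = H" using degu by (auto simp: cone_def)
  moreover have "cone H w = H" using degw by (auto simp: cone_def)
  ultimately obtain vs where vs: "distinct vs" "set vs = {1..n}" "H = pedges vs"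
    using P by (auto simp: is_path_def)
  have len: "length vs = n" using distinct_card[OF vs(1)] vs(2) by simp
  have "u = vs ! 0 \<or> u = vs ! (n - 1)"
    using path_endpoint[OF vs(1), of u] degu uw(2) unfolding vs(2) len vs(3) by blast
  moreover have "w = vs ! 0 \<or> w = vs ! (n - 1)"
    using path_endpoint[OF vs(1), of w] degw uw(3) unfolding vs(2) len vs(3) by blast
  ultimately have ends: "{u, w} = {vs ! 0, vs ! (n - 1)}" "c (vs ! 0) = c (vs ! (n - 1))"
    using uw(1) c(2) by auto
  have n2: "n \<ge> 2" using uw by auto
  \<comment> \<open>Colours alternate along the path, so equal colours at its two ends force an odd
    number of vertices.\<close>
  have "c (vs ! i) = (c (vs ! 0) = even i)" if "i < n" for i
    using that
  proof (induction i)
    case (Suc i)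
    have "(vs ! i, vs ! Suc i) \<in> H" using Suc.prems unfolding vs(3) pedges_nth len by blast
    then show ?case using c(1) Suc by fastforce
  qed simp
  from this[of "n - 1"] have "even (n - 1)" using ends(2) n2 by auto
  then have "odd n" using n2 by simp
  then have n3: "n \<ge> 3" using n2 by (cases "n = 2") auto
  have "bij_betw ((!) vs) {..<n} {1..n}"
    using bij_betw_nth[OF vs(1) refl vs(2)[symmetric]] len by simp
  moreover have "E = {{vs ! i, vs ! ((i + 1) mod n)} | i. i < n}"
  proof (rule set_eqI)
    fix e
    show "e \<in> E \<longleftrightarrow> e \<in> {{vs ! i, vs ! ((i + 1) mod n)} | i. i < n}"
    proof
      assume "e \<in> E"
      then consider "e = {u, w}" | a b where "e = {a, b}" "(a, b) \<in> H" using E by blast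
      then show "e \<in> {{vs ! i, vs ! ((i + 1) mod n)} | i. i < n}"
      proof cases
        case 1
        then have "e = {vs ! (n - 1), vs ! ((n - 1 + 1) mod n)}" using ends(1) n2 by auto
        moreover have "n - 1 < n" using n2 by simp
        ultimately show ?thesis by blast
      next
        case 2
        then obtain i where "Suc i < n" "e = {vs ! i, vs ! Suc i}"
          unfolding vs(3) pedges_nth len by auto
        then have "i < n" "e = {vs ! i, vs ! ((i + 1) mod n)}" by auto
        then show ?thesis by blast
      qed
    next
      assume "e \<in> {{vs ! i, vs ! ((i + 1) mod n)} | i. i < n}"
      then obtain i where i: "i < n" "e = {vs ! i, vs ! ((i + 1) mod n)}" by blast
      show "e \<in> E"
      proof (cases "Suc i < n")
        case True
        then have "(vs ! i, vs ! Suc i) \<in> H" unfolding vs(3) pedges_nth len by blast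
        then show ?thesis using i True E by auto
      next
        case False
        then have "Suc i = n" using i by simp
        then have "i = n - 1" "(i + 1) mod n = 0" by auto
        then have "e = {u, w}" using i(2) ends(1) by (simp add: insert_commute)
        then show ?thesis using E by blast
      qed
    qed
  qed
  ultimately show ?thesis using \<open>odd n\<close> n3 unfolding is_odd_cycle_def by blast
qed

text \<open>For ends of different colours, this exchange turns \<open>x_a x_b - y_a y_b\<close> into
  \<open>p_a q_b - q_a p_b\<close> up to sign.\<close>

lemma coloured_vertex_vars:
  fixes c :: "nat \<Rightarrow> bool"
  shows "vertex_vars n {1..n} (\<lambda>i. if c i then i else n + i) (\<lambda>i. if c i then n + i else i)"
proof
  have "k \<in> (\<lambda>i. if c i then i else n + i) ` {1..n} \<union> (\<lambda>i. if c i then n + i else i) ` {1..n}"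
    if k: "k \<in> {1..2*n}" for k
  proof -
    define i where "i = (if k \<le> n then k else k - n)"
    have "i \<in> {1..n}" "k = i \<or> k = n + i" using k by (auto simp: i_def)
    then show ?thesis by (cases "c i") (auto simp: image_iff)
  qed
  then show "(\<lambda>i. if c i then i else n + i) ` {1..n} \<union> (\<lambda>i. if c i then n + i else i) ` {1..n} = {1..2*n}"
    by (intro equalityI subsetI) (auto split: if_splits)
qed (auto simp: inj_on_def split: if_splits)

lemma reg_le_idealIG:
  assumes simple: "simple_graph n E"
    and "\<not> bipartite n E" "{u, v} \<in> E" "bipartite n (E - {{u, v}})" "\<not> is_odd_cycle n E"
  shows "reg_le n (idealIG n E :: 'k::field mpoly set) (n - 1)"
proof -
  obtain c :: "nat \<Rightarrow> bool" where c: "\<And>i j. {i, j} \<in> E - {{u, v}} \<Longrightarrow> c i \<noteq> c j"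
    using assms(4) by (auto simp: bipartite_def)
  have ij: "i \<noteq> j" "i \<in> {1..n}" "j \<in> {1..n}" if "{i, j} \<in> E" for i j
    using simple that unfolding simple_graph_def by (force simp: doubleton_eq_iff)+
  note uv = ij[OF assms(3)]
  \<comment> \<open>Otherwise \<open>c\<close> would be a proper colouring of all of
    \<open>E\<close>.\<close>
  have cuv: "c u = c v"
  proof (rule ccontr)
    assume "c u \<noteq> c v"
    have "c i \<noteq> c j" if "{i, j} \<in> E" for i j
    proof (cases "{i, j} = {u, v}")
      case True
      then show ?thesis using \<open>c u \<noteq> c v\<close> by (auto simp: doubleton_eq_iff)
    next
      case False
      then show ?thesis using that by (intro c) blast
    qed
    then show False using assms(2) unfolding bipartite_def by blast
  qed
  define H where "H = {(a, b). {a, b} \<in> E \<and> {a, b} \<noteq> {u, v}}"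
  have H: "c a \<noteq> c b" "{a, b} \<in> E" "a \<noteq> b" if "(a, b) \<in> H" for a b
  proof -
    from that have ab: "{a, b} \<in> E" "{a, b} \<noteq> {u, v}" unfolding H_def by simp_all
    show "{a, b} \<in> E" "a \<noteq> b" using ab(1) ij(1)[OF ab(1)] .
    show "c a \<noteq> c b" by (rule c) (use ab in blast)
  qed
  have G: "graph {1..n} H"
    unfolding graph_def
  proof (intro conjI)
    show "H \<subseteq> {1..n} \<times> {1..n}" by (intro subrelI SigmaI ij(2,3)[OF H(2)])
    show "sym H" by (auto simp: sym_def H_def insert_commute)
    show "irrefl H" using H(3) by (auto simp: irrefl_def)
  qed simp
  have E: "e \<in> E \<longleftrightarrow> e = {u, v} \<or> (\<exists>a b. e = {a, b} \<and> (a, b) \<in> H)" for e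
  proof
    assume "e \<in> E"
    then obtain i j where "e = {i, j}" using simple unfolding simple_graph_def by blast
    then show "e = {u, v} \<or> (\<exists>a b. e = {a, b} \<and> (a, b) \<in> H)"
      using \<open>e \<in> E\<close> by (auto simp: H_def)
  qed (use assms(3) H(2) in auto)
  have np: "\<not> is_path {1..n} (cone (cone H u) v)"
  proof
    assume "is_path {1..n} (cone (cone H u) v)"
    from path_cone_odd_cycle[OF G uv H(1) cuv this E] show False using assms(5) by simp
  qed
  have "E \<subseteq> Pow {1..n}"
  proof
    fix e assume e: "e \<in> E"
    then obtain i j where "e = {i, j}" using simple unfolding simple_graph_def by blast
    then show "e \<in> Pow {1..n}" using ij(2,3)[of i j] e by simp
  qed
  then have fin: "finite E" by (rule finite_subset) simp
  define p where "p = (\<lambda>i. if c i then i else n + i)"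
  define q where "q = (\<lambda>i. if c i then n + i else i)"
  interpret vertex_vars "TYPE('k)" n "{1..n}" p q
    unfolding p_def q_def by (rule coloured_vertex_vars)
  let ?g = "\<lambda>e. (\<Prod>i\<in>e. xv n i) - (\<Prod>i\<in>e. yv n i) :: 'k mpoly"
  have edge_eq: "edge a b = (if c a then ?g {a, b} else - ?g {a, b})" if "(a, b) \<in> H" for a b
    using H[OF that] unfolding edge_def by (auto simp: p_def q_def xv_def yv_def algebra_simps)
  \<comment> \<open>Both ends have the same colour, so the exchange affects both factors alike and
    the generator keeps its shape up to sign.\<close>
  have quad_eq: "quad u v = (if c u then ?g {u, v} else - ?g {u, v})"
    using uv(1) cuv unfolding quad_def by (auto simp: p_def q_def xv_def yv_def algebra_simps)
  have "idealIG n E = idl n (insert (quad u v) {edge a b | a b. (a, b) \<in> H})"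
  proof (rule idealIG_eq_idl[OF fin])
    fix g assume "g \<in> insert (quad u v) {edge a b | a b. (a, b) \<in> H}"
    then consider "g = quad u v" | a b where "g = edge a b" "(a, b) \<in> H" by blast
    then show "\<exists>e\<in>E. g = ?g e \<or> g = - ?g e"
    proof cases
      case 1
      then show ?thesis using assms(3) quad_eq by (intro bexI[of _ "{u, v}"]) auto
    next
      case 2
      then show ?thesis using H(2) edge_eq by (intro bexI[of _ "{a, b}"]) auto
    qed
  next
    fix e assume "e \<in> E"
    let ?I = "idl n (insert (quad u v) {edge a b | a b. (a, b) \<in> H})"
    have "\<exists>g\<in>insert (quad u v) {edge a b | a b. (a, b) \<in> H}. ?g e = g \<or> ?g e = - g"
    proof -
      consider "e = {u, v}" | a b where "e = {a, b}" "(a, b) \<in> H" using E \<open>e \<in> E\<close> by blast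
      then show ?thesis
      proof cases
        case 1
        then show ?thesis using quad_eq by (intro bexI[of _ "quad u v"]) auto
      next
        case 2
        then show ?thesis using edge_eq[OF 2(2)] by (intro bexI[of _ "edge a b"]) auto
      qed
    qed
    then obtain g where g: "g \<in> insert (quad u v) {edge a b | a b. (a, b) \<in> H}"
      and "?g e = g \<or> ?g e = - g" by blast
    then show "?g e \<in> ?I"
      by (elim disjE) (simp_all only: idl_gen[OF g] idl_uminus[OF idl_gen[OF g]])
  qed
  then show ?thesis using reg_le_quad[OF G uv(2,3,1) np] by simp
qed

theorem theorem3p6:
  fixes n :: nat and E :: "nat set set" and u v :: nat
    and b :: "nat \<Rightarrow> nat" and d :: "nat \<Rightarrow> nat \<Rightarrow> nat"
    and A :: "nat \<Rightarrow> nat \<Rightarrow> nat \<Rightarrow> 'k::field mpoly"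
  assumes "simple_graph n E"
    and "graph_connected n E"
    and "\<not> bipartite n E"
    and "{u, v} \<in> E"
    and "bipartite n (E - {{u, v}})"
    and "\<not> is_odd_cycle n E"
    and "min_graded_free_res n (idealIG n E :: 'k mpoly set) b d A"
  shows "\<forall>i j. graded_betti b d i j \<noteq> 0 \<longrightarrow> int j - int i \<le> int n - 1"
proof (intro allI impI)
  fix i j assume "graded_betti b d i j \<noteq> 0"
  then have "{k. k < b i \<and> d i k = j} \<noteq> {}" unfolding graded_betti_def by force
  then obtain k where k: "k < b i" "d i k = j" by blast
  \<comment> \<open>The edge \<open>{u, v}\<close> supplies a vertex, so \<open>n - 1\<close> on
    natural numbers agrees with the integer \<open>n - 1\<close> of the claim.\<close>
  obtain x where "x \<in> {1..n}" using assms(1,4) unfolding simple_graph_def by blast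
  then have "n \<ge> 1" by simp
  interpret koszul_resolution n "idealIG n E :: 'k mpoly set" b d A "n - 1"
    by unfold_locales (rule reg_le_idealIG[OF assms(1,3-6)], rule assms(7))
  show "int j - int i \<le> int n - 1" using shift_le[OF k(1)] k(2) \<open>n \<ge> 1\<close> by linarith
qed

end
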